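(* Let $Q_8=\{\pm 1,\pm i,\pm j,\pm k\}\subset\mathbb{H}$ act on the unit sphere $S^7\subset\mathbb{H}\oplus\mathbb{H}$ by left quaternion multiplication, and let $\eta$ be the complex 2-plane bundle on $S^7/Q_8$ associated to the 2-dimensional complex representation $y$ of $Q_8$ arising from the inclusion $Q_8\subset S^3=\operatorname{SU}(2)$. Then the tangent bundle $\tau$ of $S^7/Q_8$ satisfies $$\tau\oplus\varepsilon^1_{\mathbb{R}}\;\cong\;\eta_{\mathbb{R}}\oplus\eta_{\mathbb{R}}=2\,\eta_{\mathbb{R}}$$ as real vector bundles on $S^7/Q_8$.
   Context: $\mathbb{H}$ denotes the quaternions. $Q_8$ acts freely on the unit sphere $S^7$ of $\mathbb{H}\oplus\mathbb{H}$ (identified with $\mathbb{C}^2\oplus\mathbb{C}^2$) by left quaternion multiplication on each summand, so $S^7/Q_8$ is a smooth closed orientable 7-manifold. The representation $y$ is the 2-dimensional complex representation of $Q_8$ obtained from the inclusion of $Q_8$ in the unit quaternions $S^3=\operatorname{SU}(2)$, i.e. left multiplication on $\mathbb{H}\cong\mathbb{C}^2$; its character is $2$ at $1$, $-2$ at $-1$, and $0$ at $\pm i,\pm j,\pm k$. To a complex representation $V$ of $Q_8$ one associates the complex vector bundle on $S^7/Q_8$ with total space the orbit space $(S^7\times V)/Q_8$ (diagonal action); $\eta$ is the bundle associated to $y$. For a complex vector bundle $\zeta$, $\zeta_{\mathbb{R}}$ denotes its underlying oriented real vector bundle. $\varepsilon^k_{\mathbb{R}}$ denotes the trivial real $k$-plane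 bundle. *)

theory Defs
  imports "HOL-Analysis.Analysis" "HOL-Algebra.Group_Action"
begin

section \<open>Quotient topologies\<close>

definition quotient_topology :: "'a topology \<Rightarrow> ('a \<Rightarrow> 'b) \<Rightarrow> 'b topology" where
  "quotient_topology X f =
     topology (\<lambda>U. U \<subseteq> f ` topspace X \<and> openin X {x \<in> topspace X. f x \<in> U})"

lemma openin_quotient_topology:
  "openin (quotient_topology X f) U \<longleftrightarrow>
     U \<subseteq> f ` topspace X \<and> openin X {x \<in> topspace X. f x \<in> U}"
proof -
  have "istopology (\<lambda>U. U \<subseteq> f ` topspace X \<and> openin X {x \<in> topspace X. f x \<in> U})"
    unfolding istopology_def
  proof (intro conjI allI impI)
    fix S T
    assume S: "S \<subseteq> f ` topspace X \<and> openin X {x \<in> topspace X. f x \<in> S}"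
      and T: "T \<subseteq> f ` topspace X \<and> openin X {x \<in> topspace X. f x \<in> T}"
    have "{x \<in> topspace X. f x \<in> S \<inter> T} =
          {x \<in> topspace X. f x \<in> S} \<inter> {x \<in> topspace X. f x \<in> T}" by blast
    then show "openin X {x \<in> topspace X. f x \<in> S \<inter> T}"
      using openin_Int[OF conjunct2[OF S] conjunct2[OF T]] by simp
    show "S \<inter> T \<subseteq> f ` topspace X" using S by blast
  next
    fix K
    assume K: "\<forall>U\<in>K. U \<subseteq> f ` topspace X \<and> openin X {x \<in> topspace X. f x \<in> U}"
    then show "\<Union>K \<subseteq> f ` topspace X" by blast
    have "{x \<in> topspace X. f x \<in> \<Union>K} = (\<Union>U\<in>K. {x \<in> topspace X. f x \<in> U})" by blast
    moreover have "openin X (\<Union>U\<in>K. {x \<in> topspace X. f x \<in> U})"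
      by (rule openin_Union) (use K in blast)
    ultimately show "openin X {x \<in> topspace X. f x \<in> \<Union>K}" by simp
  qed
  then show ?thesis
    unfolding quotient_topology_def by (simp add: topology_inverse')
qed

lemma topspace_quotient_topology: "topspace (quotient_topology X f) = f ` topspace X"
proof
  show "topspace (quotient_topology X f) \<subseteq> f ` topspace X"
    by (rule conjunct1[OF iffD1[OF openin_quotient_topology openin_topspace]])
  have "{x \<in> topspace X. f x \<in> f ` topspace X} = topspace X" by blast
  then have "openin (quotient_topology X f) (f ` topspace X)"
    by (simp add: openin_quotient_topology)
  then show "f ` topspace X \<subseteq> topspace (quotient_topology X f)"
    by (rule openin_subset)
qed

lemma quotient_map_quotient_topology: "quotient_map X (quotient_topology X f) f"
  unfolding quotient_map_def topspace_quotient_topology openin_quotient_topology by blast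


section \<open>Vector bundles\<close>

text \<open>A family of \<open>'k\<close>-vector spaces over a base space. Addition is only meaningful for
  two vectors in the same fibre.\<close>

record ('k, 'b, 'e) vbundle =
  vb_base :: "'b topology"
  vb_total :: "'e topology"
  vb_proj :: "'e \<Rightarrow> 'b"
  vb_add :: "'e \<Rightarrow> 'e \<Rightarrow> 'e"
  vb_scale :: "'k \<Rightarrow> 'e \<Rightarrow> 'e"

definition bundle_iso ::
  "('k, 'b, 'e) vbundle \<Rightarrow> ('k, 'b, 'f) vbundle \<Rightarrow> ('e \<Rightarrow> 'f) \<Rightarrow> bool" where
  "bundle_iso E F h \<longleftrightarrow>
     vb_base E = vb_base F \<and>
     homeomorphic_map (vb_total E) (vb_total F) h \<and>
     (\<forall>e \<in> topspace (vb_total E). vb_proj F (h e) = vb_proj E e) \<and>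
     (\<forall>e \<in> topspace (vb_total E). \<forall>e' \<in> topspace (vb_total E). vb_proj E e = vb_proj E e' \<longrightarrow>
        h (vb_add E e e') = vb_add F (h e) (h e')) \<and>
     (\<forall>c. \<forall>e \<in> topspace (vb_total E). h (vb_scale E c e) = vb_scale F c (h e))"

definition restrict_bundle :: "('k, 'b, 'e) vbundle \<Rightarrow> 'b set \<Rightarrow> ('k, 'b, 'e) vbundle" where
  "restrict_bundle E U =
     \<lparr>vb_base = subtopology (vb_base E) U,
      vb_total = subtopology (vb_total E) (vb_proj E -` U),
      vb_proj = vb_proj E, vb_add = vb_add E, vb_scale = vb_scale E\<rparr>"

text \<open>The trivial bundle \<open>\<epsilon>\<^sup>k\<close> over \<open>B\<close>; \<^const>\<open>Euclidean_space\<close> models \<open>\<real>\<^sup>k\<close> as the space of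
  real sequences vanishing from index \<open>k\<close> on.\<close>

definition trivial_bundle :: "'b topology \<Rightarrow> nat \<Rightarrow> (real, 'b, 'b \<times> (nat \<Rightarrow> real)) vbundle" where
  "trivial_bundle B k =
     \<lparr>vb_base = B,
      vb_total = prod_topology B (Euclidean_space k),
      vb_proj = fst,
      vb_add = (\<lambda>(b, v) (_, w). (b, \<lambda>i. v i + w i)),
      vb_scale = (\<lambda>r (b, v). (b, \<lambda>i. r * v i))\<rparr>"

text \<open>The fibrewise vector space axioms are not listed: they follow from closure of the
  fibres under the operations together with local triviality.\<close>

definition real_vector_bundle :: "(real, 'b, 'e) vbundle \<Rightarrow> bool" where
  "real_vector_bundle E \<longleftrightarrow>
     continuous_map (vb_total E) (vb_base E) (vb_proj E) \<and>
     (\<forall>e \<in> topspace (vb_total E). \<forall>e' \<in> topspace (vb_total E). vb_proj E e = vb_proj E e' \<longrightarrow>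
        vb_add E e e' \<in> topspace (vb_total E) \<and> vb_proj E (vb_add E e e') = vb_proj E e) \<and>
     (\<forall>r. \<forall>e \<in> topspace (vb_total E).
        vb_scale E r e \<in> topspace (vb_total E) \<and> vb_proj E (vb_scale E r e) = vb_proj E e) \<and>
     (\<forall>b \<in> topspace (vb_base E). \<exists>U k h. openin (vb_base E) U \<and> b \<in> U \<and>
        bundle_iso (restrict_bundle E U) (trivial_bundle (subtopology (vb_base E) U) k) h)"

definition isomorphic_real_vector_bundles ::
  "(real, 'b, 'e) vbundle \<Rightarrow> (real, 'b, 'f) vbundle \<Rightarrow> bool"  (infix \<open>\<cong>\<^sub>\<real>\<close> 50) where
  "E \<cong>\<^sub>\<real> F \<longleftrightarrow> real_vector_bundle E \<and> real_vector_bundle F \<and> (\<exists>h. bundle_iso E F h)"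

definition whitney_sum ::
  "('k, 'b, 'e) vbundle \<Rightarrow> ('k, 'b, 'f) vbundle \<Rightarrow> ('k, 'b, 'e \<times> 'f) vbundle"
  (infixr \<open>\<oplus>\<^sub>V\<close> 65) where
  "E \<oplus>\<^sub>V F =
     \<lparr>vb_base = vb_base E,
      vb_total = subtopology (prod_topology (vb_total E) (vb_total F))
                   {(e, f). vb_proj E e = vb_proj F f},
      vb_proj = (\<lambda>(e, f). vb_proj E e),
      vb_add = (\<lambda>(e, f) (e', f'). (vb_add E e e', vb_add F f f')),
      vb_scale = (\<lambda>c (e, f). (vb_scale E c e, vb_scale F c f))\<rparr>"

definition underlying_real :: "(complex, 'b, 'e) vbundle \<Rightarrow> (real, 'b, 'e) vbundle" where
  "underlying_real E =
     \<lparr>vb_base = vb_base E, vb_total = vb_total E, vb_proj = vb_proj E, vb_add = vb_add E,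
      vb_scale = (\<lambda>r. vb_scale E (complex_of_real r))\<rparr>"


section \<open>Orbit spaces and associated bundles\<close>

definition orbit_space :: "('g, 'm) monoid_scheme \<Rightarrow> ('g \<Rightarrow> 'a \<Rightarrow> 'a) \<Rightarrow> 'a topology \<Rightarrow> 'a set topology"
  where "orbit_space G \<phi> X = quotient_topology X (orbit G \<phi>)"

text \<open>The bundle \<open>(X \<times> V)/G \<rightarrow> X/G\<close> for a free action \<open>\<phi>\<close> of \<open>G\<close> on \<open>X\<close> and a matrix
  representation \<open>\<rho>\<close> of \<open>G\<close> on \<open>V = k\<^sup>n\<close>. An element \<open>[x, v]\<close> of the total space is the orbit
  as a set of pairs, so that \<open>[x, v] + [x, w] = [x, v + w]\<close> and \<open>c [x, v] = [x, c v]\<close> become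
  the following set comprehensions (freeness makes them independent of choices).\<close>

definition assoc_bundle ::
  "('g, 'm) monoid_scheme \<Rightarrow> ('g \<Rightarrow> 'a \<Rightarrow> 'a) \<Rightarrow> 'a topology \<Rightarrow> ('g \<Rightarrow> 'k::real_normed_field^'n^'n) \<Rightarrow>
   ('k, 'a set, ('a \<times> ('k^'n)) set) vbundle" where
  "assoc_bundle G \<phi> X \<rho> =
     \<lparr>vb_base = orbit_space G \<phi> X,
      vb_total = orbit_space G (\<lambda>g (x, v). (\<phi> g x, \<rho> g *v v)) (prod_topology X euclidean),
      vb_proj = (\<lambda>e. fst ` e),
      vb_add = (\<lambda>e e'. {(x, v + w) | x v w. (x, v) \<in> e \<and> (x, w) \<in> e'}),
      vb_scale = (\<lambda>c e. {(x, c *s v) | x v. (x, v) \<in> e})\<rparr>"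


section \<open>Smooth structures and tangent bundles\<close>

text \<open>\<open>C_k_on k f W\<close>: \<open>f\<close> is of class \<open>C\<^sup>k\<close> on the open set \<open>W\<close>.\<close>

primrec C_k_on :: "nat \<Rightarrow> ('a::euclidean_space \<Rightarrow> 'b::real_normed_vector) \<Rightarrow> 'a set \<Rightarrow> bool" where
  "C_k_on 0 f W \<longleftrightarrow> continuous_on W f"
| "C_k_on (Suc k) f W \<longleftrightarrow>
     (\<forall>x\<in>W. f differentiable (at x)) \<and>
     (\<forall>v. C_k_on k (\<lambda>x. frechet_derivative f (at x) v) W)"

text \<open>\<open>C\<^sup>\<infinity>\<close> maps on an arbitrary subset of a Euclidean space: those which locally extend to
  \<open>C\<^sup>\<infinity>\<close> maps on open subsets of the ambient space.\<close>

definition smooth_on :: "'a::euclidean_space set \<Rightarrow> ('a \<Rightarrow> 'b::real_normed_vector) \<Rightarrow> bool" where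
  "smooth_on S f \<longleftrightarrow>
     (\<forall>x\<in>S. \<exists>W F. open W \<and> x \<in> W \<and> (\<forall>k. C_k_on k F W) \<and> (\<forall>y \<in> S \<inter> W. F y = f y))"

text \<open>A chart is a pair \<open>(U, \<phi>)\<close>; only the values of \<open>\<phi>\<close> on \<open>U\<close> matter.\<close>

type_synonym ('b, 'm) chart = "'b set \<times> ('b \<Rightarrow> 'm)"

definition topological_chart :: "'b topology \<Rightarrow> ('b, 'm::euclidean_space) chart \<Rightarrow> bool" where
  "topological_chart B = (\<lambda>(U, \<phi>).
     openin B U \<and> open (\<phi> ` U) \<and> homeomorphic_map (subtopology B U) (top_of_set (\<phi> ` U)) \<phi>)"

text \<open>The maximal atlas of a smooth submanifold \<open>S\<close> of a Euclidean space: all diffeomorphisms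
  from open subsets of \<open>S\<close> onto open subsets of the model space \<open>'m\<close>.\<close>

definition submanifold_atlas ::
  "'a::euclidean_space set \<Rightarrow> ('a, 'm::euclidean_space) chart set" where
  "submanifold_atlas S =
     {(U, \<phi>). topological_chart (top_of_set S) (U, \<phi>) \<and>
        smooth_on U \<phi> \<and> smooth_on (\<phi> ` U) (inv_into U \<phi>)}"

text \<open>For a covering map \<open>\<pi>\<close> from a manifold \<open>X\<close> with maximal atlas \<open>A\<close>, whose deck
  transformations are diffeomorphisms: the maximal atlas on the quotient
  of the unique smooth structure making \<open>\<pi>\<close> a local diffeomorphism.\<close>

definition quotient_atlas ::
  "'a topology \<Rightarrow> ('a, 'm::euclidean_space) chart set \<Rightarrow> ('a \<Rightarrow> 'b) \<Rightarrow> ('b, 'm) chart set" where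
  "quotient_atlas X A \<pi> =
     {(U, \<phi>). topological_chart (quotient_topology X \<pi>) (U, \<phi>) \<and>
        (\<forall>W. openin X W \<and> inj_on \<pi> W \<and> \<pi> ` W \<subseteq> U \<longrightarrow> (W, \<phi> \<circ> \<pi>) \<in> A)}"

text \<open>Tangent vectors at \<open>p\<close> are represented by triples \<open>(c, p, v)\<close>, where \<open>v\<close> is the
  coordinate vector in the chart \<open>c\<close>; two such are identified when the derivative of the
  change of coordinates takes one coordinate vector to the other.\<close>

definition tangent_rel ::
  "('b, 'm::euclidean_space) chart set \<Rightarrow>
   ((('b, 'm) chart \<times> 'b \<times> 'm) \<times> (('b, 'm) chart \<times> 'b \<times> 'm)) set" where
  "tangent_rel A =
     {(((U, \<phi>), p, v), ((U', \<phi>'), p', v')).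
        (U, \<phi>) \<in> A \<and> (U', \<phi>') \<in> A \<and> p = p' \<and> p \<in> U \<inter> U' \<and>
        v' = frechet_derivative (\<phi>' \<circ> inv_into U \<phi>) (at (\<phi> p)) v}"

text \<open>The tangent bundle of the manifold \<open>B\<close> with atlas \<open>A\<close>: the pieces \<open>U \<times> 'm\<close>, one for each
  chart \<open>(U, \<phi>)\<close>, glued along \<^const>\<open>tangent_rel\<close>. As for \<^const>\<open>assoc_bundle\<close>, the operations
  are those induced on equivalence classes by the operations on representatives.\<close>

definition tangent_bundle ::
  "'b topology \<Rightarrow> ('b, 'm::euclidean_space) chart set \<Rightarrow>
   (real, 'b, (('b, 'm) chart \<times> 'b \<times> 'm) set) vbundle" where
  "tangent_bundle B A =
     \<lparr>vb_base = B,
      vb_total = quotient_topology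
        (sum_topology (\<lambda>c. prod_topology (subtopology B (fst c)) euclidean) A)
        (\<lambda>t. tangent_rel A `` {t}),
      vb_proj = (\<lambda>e. THE p. \<exists>c v. (c, p, v) \<in> e),
      vb_add = (\<lambda>e e'. {(c, p, v + w) | c p v w. (c, p, v) \<in> e \<and> (c, p, w) \<in> e'}),
      vb_scale = (\<lambda>r e. {(c, p, r *\<^sub>R v) | c p v. (c, p, v) \<in> e})\<rparr>"


section \<open>Quaternions, the group \<open>Q\<^sub>8\<close> and the manifold \<open>S\<^sup>7/Q\<^sub>8\<close>\<close>

text \<open>The pair \<open>(a, b)\<close> stands for the quaternion \<open>a + j b\<close>. With \<open>b\<close> on the right of \<open>j\<close>, left
  multiplications are complex linear for the complex structure given by right multiplication
  by \<open>i\<close>, which is the componentwise one on pairs. As \<open>z j = j z\<^sup>*\<close> for complex \<open>z\<close>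
  (with conjugate \<open>z\<^sup>*\<close>), \<open>(a + j b) (c + j d) = (a c - b\<^sup>* d) + j (a\<^sup>* d + b c)\<close>. The norm of
  the product type is the Euclidean one, i.e. the quaternion norm.\<close>

type_synonym quat = "complex \<times> complex"

definition qmult :: "quat \<Rightarrow> quat \<Rightarrow> quat"  (infixl \<open>\<bullet>\<^sub>q\<close> 70) where
  "p \<bullet>\<^sub>q q = (fst p * fst q - cnj (snd p) * snd q, cnj (fst p) * snd q + snd p * fst q)"

definition q1 :: quat where "q1 = (1, 0)"
definition qi :: quat where "qi = (\<i>, 0)"
definition qj :: quat where "qj = (0, 1)"
definition qk :: quat where "qk = (0, - \<i>)"

lemma qmult_assoc: "(p \<bullet>\<^sub>q q) \<bullet>\<^sub>q r = p \<bullet>\<^sub>q (q \<bullet>\<^sub>q r)"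
  by (simp add: qmult_def algebra_simps)

lemma q1_qmult [simp]: "q1 \<bullet>\<^sub>q p = p" and qmult_q1 [simp]: "p \<bullet>\<^sub>q q1 = p"
  by (simp_all add: qmult_def q1_def)

lemma hamilton_relations:
  "qi \<bullet>\<^sub>q qi = - q1" "qj \<bullet>\<^sub>q qj = - q1" "qk \<bullet>\<^sub>q qk = - q1"
  "qi \<bullet>\<^sub>q qj = qk" "qj \<bullet>\<^sub>q qk = qi" "qk \<bullet>\<^sub>q qi = qj"
  "qj \<bullet>\<^sub>q qi = - qk" "qk \<bullet>\<^sub>q qj = - qi" "qi \<bullet>\<^sub>q qk = - qj"
  by (simp_all add: qmult_def q1_def qi_def qj_def qk_def)

lemma qmult_minus [simp]: "(- p) \<bullet>\<^sub>q q = - (p \<bullet>\<^sub>q q)" "p \<bullet>\<^sub>q (- q) = - (p \<bullet>\<^sub>q q)"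
  by (simp_all add: qmult_def)

definition Q8 :: "quat monoid" where
  "Q8 = \<lparr>carrier = {q1, - q1, qi, - qi, qj, - qj, qk, - qk}, monoid.mult = qmult, one = q1\<rparr>"

lemma group_Q8: "group Q8"
proof (rule groupI)
  show "\<exists>y\<in>carrier Q8. y \<otimes>\<^bsub>Q8\<^esub> x = \<one>\<^bsub>Q8\<^esub>" if "x \<in> carrier Q8" for x
    using that by (auto simp: Q8_def hamilton_relations)
qed (auto simp: Q8_def qmult_assoc hamilton_relations)

lemma card_Q8: "card (carrier Q8) = 8"
  by (simp add: Q8_def q1_def qi_def qj_def qk_def complex_eq_iff)

definition S7 :: "(quat \<times> quat) set" where
  "S7 = sphere 0 1"

definition Q8_act :: "quat \<Rightarrow> quat \<times> quat \<Rightarrow> quat \<times> quat" where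
  "Q8_act g x = (g \<bullet>\<^sub>q fst x, g \<bullet>\<^sub>q snd x)"

lemma norm_qmult: "norm (p \<bullet>\<^sub>q q) = norm p * norm q"
proof -
  have "(norm (p \<bullet>\<^sub>q q))\<^sup>2 = (norm p * norm q)\<^sup>2"
    by (simp add: qmult_def norm_prod_def power_mult_distrib cmod_power2)
       (simp add: power2_eq_square algebra_simps)
  then show ?thesis by simp
qed

lemma Q8_act_S7: "g \<in> carrier Q8 \<Longrightarrow> x \<in> S7 \<Longrightarrow> Q8_act g x \<in> S7"
  by (cases x)
     (auto simp: S7_def Q8_act_def norm_Pair norm_qmult Q8_def q1_def qi_def qj_def qk_def)

lemma Q8_act_free:
  assumes "x \<in> S7" "Q8_act g x = x"
  shows "g = q1"
proof -
  have distr: "(g - q1) \<bullet>\<^sub>q p = g \<bullet>\<^sub>q p - p" for p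
    by (simp add: qmult_def q1_def prod_eq_iff algebra_simps)
  have "norm (g - q1) * norm (fst x) = 0" "norm (g - q1) * norm (snd x) = 0"
    using assms(2) by (simp_all add: Q8_act_def prod_eq_iff distr flip: norm_qmult)
  moreover have "fst x \<noteq> 0 \<or> snd x \<noteq> 0"
    using assms(1) by (auto simp: S7_def norm_prod_def)
  ultimately show ?thesis by auto
qed

definition S7_mod_Q8 :: "(quat \<times> quat) set topology" where
  "S7_mod_Q8 = orbit_space Q8 Q8_act (top_of_set S7)"

definition S7_mod_Q8_atlas :: "((quat \<times> quat) set, real^7) chart set" where
  "S7_mod_Q8_atlas = quotient_atlas (top_of_set S7) (submanifold_atlas S7) (orbit Q8 Q8_act)"

text \<open>The identification of the unit quaternions with \<open>SU(2)\<close>.\<close>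

definition rep_y :: "quat \<Rightarrow> complex^2^2" where
  "rep_y g = vector [vector [fst g, - cnj (snd g)], vector [snd g, cnj (fst g)]]"

lemma rep_y_left_mult:
  "rep_y g *v vector [fst h, snd h] = vector [fst (g \<bullet>\<^sub>q h), snd (g \<bullet>\<^sub>q h)]"
  by (simp add: rep_y_def qmult_def vec_eq_iff forall_2 matrix_vector_mult_def sum_2)

lemma rep_y_mult: "rep_y (g \<bullet>\<^sub>q h) = rep_y g ** rep_y h" and rep_y_one: "rep_y q1 = mat 1"
  by (simp_all add: rep_y_def qmult_def q1_def vec_eq_iff forall_2 matrix_matrix_mult_def sum_2
      mat_def algebra_simps)

lemma rep_y_character:
  "trace (rep_y q1) = 2" "trace (rep_y (- q1)) = - 2"
  "g \<in> carrier Q8 - {q1, - q1} \<Longrightarrow> trace (rep_y g) = 0"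
  by (auto simp: rep_y_def trace_def sum_2 Q8_def q1_def qi_def qj_def qk_def)

definition eta :: "(complex, (quat \<times> quat) set, ((quat \<times> quat) \<times> (complex^2)) set) vbundle" where
  "eta = assoc_bundle Q8 Q8_act (top_of_set S7) rep_y"

end

theory Submission
  imports Defs
begin

text \<open>Write \<open>\<pi>\<close> for the orbit map of \<open>S\<^sup>7\<close>. Both bundles are quotients of \<open>S\<^sup>7 \<times> (H \<oplus> H)\<close> by the
  diagonal action of \<open>Q\<^sub>8\<close>: for \<open>2 \<eta>\<close> this is the definition, and for \<open>\<tau> \<oplus> \<epsilon>\<^sup>1\<close> the quotient map
  sends \<open>(x, u)\<close> to the image under the derivative of \<open>\<pi>\<close> of the component of \<open>u\<close> tangent to
  \<open>S\<^sup>7\<close> at \<open>x\<close>, paired with the radial component \<open>x \<bullet> u\<close>. It is invariant because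
  \<open>Q\<^sub>8\<close> acts by linear isometries. Two bundles that are quotients of the same trivial bundle
  with the same identifications are isomorphic, and local sections of \<open>\<pi>\<close> trivialise them.\<close>

section \<open>Bundles presented by a trivial bundle over a covering\<close>

text \<open>The two sides are glued differently: \<open>assoc_bundle\<close> from group orbits,
  \<open>tangent_bundle\<close> from all charts of a maximal atlas related by derivatives of
  transition maps. The format \<open>presented_bundle\<close> hides this, and the isomorphism is
  never written down: it is induced between two quotients with equal kernels. Invariance under
  \<open>Q8\<close> gives one half of the kernel; injectivity on fibres gives the other. Presenting
  maps are required to be open, because openness can be checked on small boxes, hence passes to
  Whitney sums and restricts to sheets. The main work lies on the tangent side. Charts of the sphere
  are smooth only through local ambient extensions, so derivatives are taken after precomposing with
  the radial retraction \<open>sgn\<close>; then transition maps, invariance and the splitting into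
  tangential and radial parts become statements about linear maps of the ambient space. Charts must
  also be shown to exist; they are built from linear maps, products and one square root, and
  \<open>C_k_on\<close> is propagated through each of these.\<close>

lemma homeomorphic_map_restrict_inj_on:
  assumes "continuous_map X Y f" "open_map X Y f" "openin X W" "inj_on f W"
  shows "homeomorphic_map (subtopology X W) (subtopology Y (f ` W)) f"
proof (rule bijective_open_imp_homeomorphic_map)
  have W: "W \<subseteq> topspace X" using assms(3) by (rule openin_subset)
  show "continuous_map (subtopology X W) (subtopology Y (f ` W)) f"
    using assms(1) W by (auto simp: continuous_map_in_subtopology continuous_map_from_subtopology)
  show "open_map (subtopology X W) (subtopology Y (f ` W)) f"
    unfolding open_map_def openin_open_subtopology[OF assms(3)]
  proof (intro allI impI)
    fix U assume "openin X U \<and> U \<subseteq> W"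
    then have "openin Y (f ` U)" "f ` U \<subseteq> f ` W"
      using assms(2) by (auto simp: open_map_def)
    then show "openin (subtopology Y (f ` W)) (f ` U)"
      by (rule subset_openin_subtopology)
  qed
  show "f ` topspace (subtopology X W) = topspace (subtopology Y (f ` W))"
    using W continuous_map_image_subset_topspace[OF assms(1)] by auto
  show "inj_on f (topspace (subtopology X W))"
    using assms(4) by (auto simp: inj_on_def)
qed

text \<open>Each quotient map descends along the other, and the two induced maps are inverse to each
  other because both quotient maps are onto.\<close>

lemma homeomorphic_map_of_same_kernel:
  assumes f: "quotient_map X Y f" and g: "quotient_map X Z g"
    and ker: "\<And>x y. x \<in> topspace X \<Longrightarrow> y \<in> topspace X \<Longrightarrow> f x = f y \<longleftrightarrow> g x = g y"
  obtains h where "homeomorphic_map Y Z h" "\<And>x. x \<in> topspace X \<Longrightarrow> h (f x) = g x"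
proof -
  obtain h where h: "continuous_map Y Z h" "\<And>x. x \<in> topspace X \<Longrightarrow> h (f x) = g x"
    using quotient_map_lift_exists[OF f quotient_imp_continuous_map[OF g]] ker by metis
  obtain k where k: "continuous_map Z Y k" "\<And>x. x \<in> topspace X \<Longrightarrow> k (g x) = f x"
    using quotient_map_lift_exists[OF g quotient_imp_continuous_map[OF f]] ker by metis
  have "homeomorphic_maps Y Z h k"
    unfolding homeomorphic_maps_def
    using h k quotient_imp_surjective_map[OF f] quotient_imp_surjective_map[OF g]
    by (metis (no_types, lifting) image_iff)
  then show thesis
    using that h(2) homeomorphic_maps_imp_map by blast
qed

text \<open>Translates an arbitrary Euclidean fibre into the sequence model used by
  \<open>trivial_bundle\<close>. The enumeration of \<open>Basis\<close> is arbitrary; the zeros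
  from \<open>DIM('v)\<close> on are what membership in \<open>Euclidean_space\<close>
  demands.\<close>

definition coords :: "'v::euclidean_space \<Rightarrow> nat \<Rightarrow> real" where
  "coords v i = (if i < DIM('v) then v \<bullet> from_nat_into Basis i else 0)"

lemma coords_add: "coords (v + w) = (\<lambda>i. coords v i + coords w i)"
  and coords_scaleR: "coords (r *\<^sub>R v) = (\<lambda>i. r * coords v i)"
  by (auto simp: coords_def inner_add_left)

lemma homeomorphic_map_coords:
  "homeomorphic_map euclidean (Euclidean_space DIM('v)) (coords :: 'v::euclidean_space \<Rightarrow> _)"
proof -
  let ?b = "from_nat_into (Basis :: 'v set)"
  let ?g = "\<lambda>x::nat \<Rightarrow> real. \<Sum>i<DIM('v). x i *\<^sub>R ?b i"
  have bij: "bij_betw ?b {..<DIM('v)} Basis"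
    using bij_betw_from_nat_into_finite[of "Basis :: 'v set"] by simp
  have inner_b: "?b i \<bullet> ?b j = (if i = j then 1 else 0)" if "i < DIM('v)" "j < DIM('v)" for i j
  proof -
    have "?b i \<in> Basis" "?b j \<in> Basis" "?b i = ?b j \<longleftrightarrow> i = j"
      using bij that by (auto simp: bij_betw_def inj_on_def)
    then show ?thesis by (simp add: inner_Basis)
  qed
  have "homeomorphic_maps euclidean (Euclidean_space DIM('v)) (coords :: 'v \<Rightarrow> _) ?g"
    unfolding homeomorphic_maps_def
  proof (intro conjI ballI)
    show "continuous_map euclidean (Euclidean_space DIM('v)) (coords :: 'v \<Rightarrow> _)"
    proof -
      have "continuous_map euclidean euclideanreal (\<lambda>v::'v. v \<bullet> ?b i)" for i
        unfolding continuous_map_iff_continuous2 by (intro continuous_intros)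
      then show ?thesis
        unfolding coords_def[abs_def] continuous_map_componentwise_Euclidean_space by blast
    qed
    show "continuous_map (Euclidean_space DIM('v)) euclidean ?g"
      unfolding continuous_map_Euclidean_space_iff
      by (intro continuous_on_sum continuous_on_scaleR continuous_on_const
          continuous_on_subset[OF continuous_on_product_coordinates]) simp
    show "?g (coords v) = v" for v :: 'v
    proof -
      have "?g (coords v) = (\<Sum>i<DIM('v). (v \<bullet> ?b i) *\<^sub>R ?b i)"
        by (intro sum.cong) (auto simp: coords_def)
      also have "\<dots> = (\<Sum>b\<in>Basis. (v \<bullet> b) *\<^sub>R b)"
        by (rule sum.reindex_bij_betw[OF bij])
      finally show ?thesis by (simp add: euclidean_representation)
    qed
    show "coords (?g x) = x" if "x \<in> topspace (Euclidean_space DIM('v))" for x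
    proof
      fix i
      have "?g x \<bullet> ?b i = x i" if "i < DIM('v)"
      proof -
        have "?g x \<bullet> ?b i = (\<Sum>j<DIM('v). if i = j then x j else 0)"
          unfolding inner_sum_left using that by (intro sum.cong) (auto simp: inner_b)
        then show ?thesis using that by simp
      qed
      then show "coords (?g x) i = x i"
        using that by (auto simp: coords_def topspace_Euclidean_space)
    qed
  qed
  then show ?thesis by (rule homeomorphic_maps_imp_map)
qed

text \<open>An open, locally injective continuous surjection: enough to have continuous local
  sections, namely the inverses on sheets.\<close>

locale covering_quotient =
  fixes X :: "'a topology" and B :: "'b topology" and \<pi> :: "'a \<Rightarrow> 'b"
  assumes cont: "continuous_map X B \<pi>"
    and open_map: "open_map X B \<pi>"
    and onto: "\<pi> ` topspace X = topspace B"
    and locally_inj: "x \<in> topspace X \<Longrightarrow> \<exists>W. openin X W \<and> x \<in> W \<and> inj_on \<pi> W"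
begin

lemma openin_image: "openin X W \<Longrightarrow> openin B (\<pi> ` W)"
  using open_map by (simp add: open_map_def)

lemma homeomorphic_map_on_sheet:
  "openin X W \<Longrightarrow> inj_on \<pi> W \<Longrightarrow> homeomorphic_map (subtopology X W) (subtopology B (\<pi> ` W)) \<pi>"
  by (rule homeomorphic_map_restrict_inj_on[OF cont open_map])

lemma continuous_map_inv_into:
  assumes "openin X W" "inj_on \<pi> W"
  shows "continuous_map (subtopology B (\<pi> ` W)) (subtopology X W) (inv_into W \<pi>)"
proof -
  have W: "W \<subseteq> topspace X" using assms(1) by (rule openin_subset)
  obtain s where s: "homeomorphic_maps (subtopology X W) (subtopology B (\<pi> ` W)) \<pi> s"
    using homeomorphic_map_on_sheet[OF assms] by (auto simp: homeomorphic_map_maps)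
  have eq: "s b = inv_into W \<pi> b" if "b \<in> topspace (subtopology B (\<pi> ` W))" for b
    using that s W assms(2) by (auto simp: homeomorphic_maps_def)
  show ?thesis
    by (rule continuous_map_eq[of _ _ s]) (use s eq in \<open>auto simp: homeomorphic_maps_def\<close>)
qed

end

text \<open>Together with \<open>q_inj\<close>, the last condition makes \<open>v \<mapsto> q (x, v)\<close> a bijection onto the
  whole fibre over \<open>\<pi> x\<close>.\<close>

locale presented_bundle = covering_quotient X B \<pi>
  for X :: "'a topology" and B :: "'b topology" and \<pi> +
  fixes E :: "(real, 'b, 'e) vbundle" and q :: "'a \<times> 'v::euclidean_space \<Rightarrow> 'e"
  assumes base: "vb_base E = B"
    and q_cont: "continuous_map (prod_topology X euclidean) (vb_total E) q"
    and q_open: "open_map (prod_topology X euclidean) (vb_total E) q"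
    and q_onto: "q ` (topspace X \<times> UNIV) = topspace (vb_total E)"
    and proj: "x \<in> topspace X \<Longrightarrow> vb_proj E (q (x, v)) = \<pi> x"
    and add: "x \<in> topspace X \<Longrightarrow> vb_add E (q (x, v)) (q (x, w)) = q (x, v + w)"
    and scale: "x \<in> topspace X \<Longrightarrow> vb_scale E r (q (x, v)) = q (x, r *\<^sub>R v)"
    and q_inj: "x \<in> topspace X \<Longrightarrow> q (x, v) = q (x, w) \<Longrightarrow> v = w"
    and transport: "x \<in> topspace X \<Longrightarrow> y \<in> topspace X \<Longrightarrow> \<pi> x = \<pi> y \<Longrightarrow> \<exists>w. q (y, v) = q (x, w)"
begin

lemma quotient_map: "quotient_map (prod_topology X euclidean) (vb_total E) q"
  using continuous_open_imp_quotient_map[OF q_cont q_open] q_onto by simp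

lemma total_cases:
  assumes "e \<in> topspace (vb_total E)"
  obtains x v where "x \<in> topspace X" "e = q (x, v)"
  using assms q_onto by (metis (no_types, lifting) SigmaE imageE)

lemma q_in_total: "x \<in> topspace X \<Longrightarrow> q (x, v) \<in> topspace (vb_total E)"
  using q_onto by auto

text \<open>The point representing a fibre can be prescribed, by \<open>transport\<close>. This
  matters because \<open>add\<close> describes sums only for vectors presented over the same point
  of \<open>X\<close>.\<close>

lemma total_at:
  assumes "e \<in> topspace (vb_total E)" "x \<in> topspace X" "vb_proj E e = \<pi> x"
  obtains v where "e = q (x, v)"
proof -
  obtain y w where y: "y \<in> topspace X" "e = q (y, w)" using total_cases[OF assms(1)] .
  then have "\<pi> x = \<pi> y" using assms(3) proj by simp
  then show thesis using transport[OF assms(2) y(1)] y(2) that by metis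
qed

lemma common_fibre:
  assumes "e \<in> topspace (vb_total E)" "e' \<in> topspace (vb_total E)" "vb_proj E e = vb_proj E e'"
  obtains x v w where "x \<in> topspace X" "e = q (x, v)" "e' = q (x, w)"
proof -
  obtain x v where x: "x \<in> topspace X" "e = q (x, v)" using total_cases[OF assms(1)] .
  then have "vb_proj E e' = \<pi> x" using assms(3) proj by simp
  with total_at[OF assms(2) x(1)] that x show thesis by metis
qed

text \<open>Over a sheet \<open>W\<close> the map \<open>q\<close> is injective, since equal
  projections force equal points of \<open>W\<close>. Its inverse over the image of
  \<open>W\<close>, followed by \<open>\<pi>\<close> on points and \<open>coords\<close> on vectors,
  is the trivialisation.\<close>

lemma local_triviality:
  assumes "b \<in> topspace B"
  shows "\<exists>U k h. openin B U \<and> b \<in> U \<and>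
    bundle_iso (restrict_bundle E U) (trivial_bundle (subtopology B U) k) h"
proof -
  obtain x W where W: "x \<in> W" "b = \<pi> x" "openin X W" "inj_on \<pi> W"
    using assms onto locally_inj by (metis imageE)
  have WX: "W \<subseteq> topspace X" using W(3) by (rule openin_subset)
  define U where "U = \<pi> ` W"
  let ?Y = "prod_topology (subtopology X W) (euclidean :: 'v topology)"
  let ?EU = "subtopology (vb_total E) (vb_proj E -` U)"
  have Y: "?Y = subtopology (prod_topology X euclidean) (W \<times> UNIV)"
    by (simp add: subtopology_Times)
  have inj: "inj_on q (W \<times> UNIV)"
  proof (rule inj_onI, clarify)
    fix y v z w assume *: "y \<in> W" "z \<in> W" "q (y, v) = q (z, w)"
    then have "\<pi> y = \<pi> z" using proj WX by (metis subsetD)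
    then have "y = z" using * W(4) by (auto dest: inj_onD)
    then show "y = z \<and> v = w" using * q_inj WX by blast
  qed
  have image: "q ` (W \<times> UNIV) = topspace (vb_total E) \<inter> vb_proj E -` U"
  proof
    show "q ` (W \<times> UNIV) \<subseteq> topspace (vb_total E) \<inter> vb_proj E -` U"
      using WX proj q_in_total by (auto simp: U_def subset_iff)
    show "topspace (vb_total E) \<inter> vb_proj E -` U \<subseteq> q ` (W \<times> UNIV)"
    proof
      fix e assume "e \<in> topspace (vb_total E) \<inter> vb_proj E -` U"
      then obtain z where "z \<in> W" "vb_proj E e = \<pi> z" "e \<in> topspace (vb_total E)"
        by (auto simp: U_def)
      then show "e \<in> q ` (W \<times> UNIV)" using WX by (auto elim!: total_at[of e z])
    qed
  qed
  have "openin (prod_topology X euclidean) (W \<times> (UNIV :: 'v set))"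
    using W(3) by (simp add: openin_prod_Times_iff)
  from homeomorphic_map_restrict_inj_on[OF q_cont q_open this inj]
  have "homeomorphic_map ?Y ?EU q"
    by (simp only: Y image subtopology_restrict)
  then obtain g where g: "homeomorphic_maps ?Y ?EU q g"
    by (auto simp: homeomorphic_map_maps)
  let ?P = "\<lambda>(y, v::'v). (\<pi> y, coords v)"
  have "homeomorphic_map ?Y (prod_topology (subtopology B U) (Euclidean_space DIM('v))) ?P"
  proof -
    obtain s where "homeomorphic_maps (subtopology X W) (subtopology B U) \<pi> s"
      using homeomorphic_map_on_sheet[OF W(3,4)] unfolding homeomorphic_map_maps U_def by blast
    moreover obtain t where
      "homeomorphic_maps euclidean (Euclidean_space DIM('v)) (coords :: 'v \<Rightarrow> _) t"
      using homeomorphic_map_coords unfolding homeomorphic_map_maps by blast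
    ultimately have "homeomorphic_maps ?Y (prod_topology (subtopology B U) (Euclidean_space DIM('v)))
      ?P (\<lambda>(y, v). (s y, t v))"
      by (simp add: homeomorphic_maps_prod)
    then show ?thesis by (rule homeomorphic_maps_imp_map)
  qed
  moreover have "homeomorphic_map ?EU ?Y g"
    using g homeomorphic_maps_map by blast
  ultimately have homeo: "homeomorphic_map ?EU
      (prod_topology (subtopology B U) (Euclidean_space DIM('v))) (?P \<circ> g)"
    using homeomorphic_map_compose by blast
  have h_q: "(?P \<circ> g) (q (y, v)) = (\<pi> y, coords v)" if "y \<in> W" for y v
    using g that WX by (auto simp: homeomorphic_maps_def)
  have sheet_cases: thesis
    if "e \<in> topspace ?EU" "\<And>y v. y \<in> W \<Longrightarrow> y \<in> topspace X \<Longrightarrow> e = q (y, v) \<Longrightarrow> thesis" for e thesis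
  proof -
    have "e \<in> q ` (W \<times> UNIV)" unfolding image using that(1) by simp
    then show thesis using that(2) WX by blast
  qed
  have "bundle_iso (restrict_bundle E U) (trivial_bundle (subtopology B U) DIM('v)) (?P \<circ> g)"
    unfolding bundle_iso_def restrict_bundle_def trivial_bundle_def vbundle.simps
  proof (intro conjI ballI allI impI)
    show "subtopology (vb_base E) U = subtopology B U" by (simp add: base)
    show "homeomorphic_map ?EU (prod_topology (subtopology B U) (Euclidean_space DIM('v))) (?P \<circ> g)"
      by (rule homeo)
  next
    fix e assume "e \<in> topspace ?EU"
    then show "fst ((?P \<circ> g) e) = vb_proj E e"
      using h_q proj by (elim sheet_cases) (simp del: o_apply)
  next
    \<comment> \<open>Both vectors are rewritten over the one point \<open>y\<close> of the sheet,
      where addition is addition in the model fibre.\<close>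
    fix e e' assume e: "e \<in> topspace ?EU" "e' \<in> topspace ?EU" and same: "vb_proj E e = vb_proj E e'"
    obtain y v where y: "y \<in> W" "y \<in> topspace X" "e = q (y, v)" using sheet_cases[OF e(1)] .
    have "e' \<in> topspace (vb_total E)" "vb_proj E e' = \<pi> y" using e(2) same y proj by auto
    then obtain w where w: "e' = q (y, w)" using total_at y(2) by blast
    show "(?P \<circ> g) (vb_add E e e') =
      (case (?P \<circ> g) e of (b, v) \<Rightarrow> \<lambda>(_, w). (b, \<lambda>i. v i + w i)) ((?P \<circ> g) e')"
      unfolding y(3) w add[OF y(2)] h_q[OF y(1)] by (simp add: coords_add)
  next
    fix r e assume "e \<in> topspace ?EU"
    then obtain y v where y: "y \<in> W" "y \<in> topspace X" "e = q (y, v)" using sheet_cases by blast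
    show "(?P \<circ> g) (vb_scale E r e) = (case (?P \<circ> g) e of (b, v) \<Rightarrow> (b, \<lambda>i. r * v i))"
      unfolding y(3) scale[OF y(2)] h_q[OF y(1)] by (simp add: coords_scaleR)
  qed
  then show ?thesis
    using openin_image[OF W(3)] W(1,2) unfolding U_def by blast
qed

lemma real_vector_bundle: "real_vector_bundle E"
  unfolding real_vector_bundle_def base
proof (intro conjI ballI allI impI)
  \<comment> \<open>Continuity of the projection is tested upstairs, where it becomes
    \<open>\<pi> \<circ> fst\<close>.\<close>
  have "continuous_map (prod_topology X euclidean) B (vb_proj E \<circ> q)"
    by (rule continuous_map_eq[of _ _ "\<pi> \<circ> fst"])
      (auto intro!: continuous_map_compose[OF continuous_map_fst cont] simp: proj)
  then show "continuous_map (vb_total E) B (vb_proj E)"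
    by (rule continuous_compose_quotient_map[OF quotient_map])
next
  fix e e' assume "e \<in> topspace (vb_total E)" "e' \<in> topspace (vb_total E)" "vb_proj E e = vb_proj E e'"
  then obtain x v w where "x \<in> topspace X" "e = q (x, v)" "e' = q (x, w)"
    by (rule common_fibre)
  then show "vb_add E e e' \<in> topspace (vb_total E)" "vb_proj E (vb_add E e e') = vb_proj E e"
    by (simp_all add: add proj q_in_total)
qed (use local_triviality in \<open>auto simp: scale proj q_in_total elim!: total_cases\<close>)

end

text \<open>The induced homeomorphism sends \<open>q (x, v)\<close> to \<open>r (x, v)\<close>; with
  the same \<open>x\<close> and \<open>v\<close> on both sides, compatibility with projection and
  linear structure is read off from the two presentations.\<close>

lemma isomorphic_of_presentations:
  assumes "presented_bundle X B \<pi> E q" "presented_bundle X B \<pi> F r"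
    and ker: "\<And>x y. x \<in> topspace X \<times> UNIV \<Longrightarrow> y \<in> topspace X \<times> UNIV \<Longrightarrow> q x = q y \<longleftrightarrow> r x = r y"
  shows "E \<cong>\<^sub>\<real> F"
proof -
  interpret E: presented_bundle X B \<pi> E q by fact
  interpret F: presented_bundle X B \<pi> F r by fact
  obtain h where h: "homeomorphic_map (vb_total E) (vb_total F) h"
      "\<And>z. z \<in> topspace (prod_topology X euclidean) \<Longrightarrow> h (q z) = r z"
    by (rule homeomorphic_map_of_same_kernel[OF E.quotient_map F.quotient_map])
      (use ker in auto)
  then have h': "h (q (x, v)) = r (x, v)" if "x \<in> topspace X" for x v
    using that by simp
  have "bundle_iso E F h"
    unfolding bundle_iso_def
  proof (intro conjI ballI allI impI)
    show "h (vb_add E e e') = vb_add F (h e) (h e')"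
      if "e \<in> topspace (vb_total E)" "e' \<in> topspace (vb_total E)" "vb_proj E e = vb_proj E e'" for e e'
      by (rule E.common_fibre[OF that]) (simp add: E.add F.add h')
  qed (use h(1) in \<open>auto simp: E.base F.base E.proj F.proj E.scale F.scale h' elim!: E.total_cases\<close>)
  then show ?thesis
    unfolding isomorphic_real_vector_bundles_def
    using E.real_vector_bundle F.real_vector_bundle by blast
qed

text \<open>The delicate point is openness: the total space of the sum is a fibre product, and a
  pair in it may come from different points over the same base point. Shrinking to a sheet rules
  this out.\<close>

lemma presented_bundle_whitney_sum:
  fixes q :: "'a \<times> 'v::euclidean_space \<Rightarrow> 'e" and r :: "'a \<times> 'w::euclidean_space \<Rightarrow> 'f"
  assumes "presented_bundle X B \<pi> E q" "presented_bundle X B \<pi> F r"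
  shows "presented_bundle X B \<pi> (E \<oplus>\<^sub>V F) (\<lambda>(x, v, w). (q (x, v), r (x, w)))"
proof -
  interpret E: presented_bundle X B \<pi> E q by fact
  interpret F: presented_bundle X B \<pi> F r by fact
  let ?s = "\<lambda>(x, v, w). (q (x, v), r (x, w))"
  let ?X = "prod_topology X (euclidean :: ('v \<times> 'w) topology)"
  have cont: "continuous_map ?X (vb_total (E \<oplus>\<^sub>V F)) ?s"
  proof -
    have "continuous_map ?X (vb_total E) (\<lambda>z. q (fst z, fst (snd z)))"
      "continuous_map ?X (vb_total F) (\<lambda>z. r (fst z, snd (snd z)))"
      using continuous_map_compose[OF _ E.q_cont, of ?X "\<lambda>z. (fst z, fst (snd z))"]
        continuous_map_compose[OF _ F.q_cont, of ?X "\<lambda>z. (fst z, snd (snd z))"]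
        continuous_map_compose[OF continuous_map_snd, of _ euclidean "fst :: 'v \<times> 'w \<Rightarrow> _" X]
        continuous_map_compose[OF continuous_map_snd, of _ euclidean "snd :: 'v \<times> 'w \<Rightarrow> _" X]
      by (simp_all add: o_def continuous_map_paired continuous_map_fst continuous_on_fst continuous_on_snd)
    then show ?thesis
      by (auto simp: whitney_sum_def continuous_map_in_subtopology continuous_map_paired
          case_prod_unfold E.proj F.proj)
  qed
  have "openin (vb_total (E \<oplus>\<^sub>V F)) (?s ` O')" if O': "openin ?X O'" for O'
  proof (subst openin_subopen, intro ballI)
    fix e assume "e \<in> ?s ` O'"
    then obtain x v w where z: "(x, v, w) \<in> O'" "e = (q (x, v), r (x, w))" by auto
    obtain W N where WN: "openin X W" "open N" "x \<in> W" "(v, w) \<in> N" "W \<times> N \<subseteq> O'"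
      using O' z(1) unfolding openin_prod_topology_alt by (metis open_openin)
    obtain V1 V2 where V: "open V1" "open V2" "v \<in> V1" "w \<in> V2" "V1 \<times> V2 \<subseteq> N"
      using WN(2,4) by (metis open_prod_elim SigmaD1 SigmaD2)
    have xX: "x \<in> topspace X" using WN openin_subset by blast
    obtain S where S: "openin X S" "x \<in> S" "inj_on \<pi> S" using E.locally_inj[OF xX] by blast
    \<comment> \<open>On a subset of the sheet \<open>S\<close>, two points with the same projection
      coincide, so every pair in \<open>?T\<close> has a single base point and is the image of one
      triple.\<close>
    define R where "R = W \<inter> S"
    have R: "openin X R" "x \<in> R" "inj_on \<pi> R" "R \<subseteq> W"
      using WN S by (auto simp: R_def inj_on_def)
    have RX: "R \<subseteq> topspace X" using R(1) by (rule openin_subset)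
    let ?T = "(q ` (R \<times> V1)) \<times> (r ` (R \<times> V2)) \<inter> {(e, f). vb_proj E e = vb_proj F f}"
    have "openin (vb_total E) (q ` (R \<times> V1))" "openin (vb_total F) (r ` (R \<times> V2))"
      using E.q_open F.q_open R(1) V by (auto simp: open_map_def openin_prod_Times_iff)
    then have "openin (vb_total (E \<oplus>\<^sub>V F)) ?T"
      unfolding whitney_sum_def by (simp add: openin_subtopology_Int openin_prod_Times_iff)
    moreover have "e \<in> ?T"
      using z R V xX by (auto simp: E.proj F.proj)
    moreover have "?T \<subseteq> ?s ` O'"
    proof
      fix t assume "t \<in> ?T"
      then obtain y a z b where t: "t = (q (y, a), r (z, b))" "y \<in> R" "z \<in> R" "a \<in> V1" "b \<in> V2"
        "vb_proj E (q (y, a)) = vb_proj F (r (z, b))"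
        by (auto simp: whitney_sum_def)
      then have "\<pi> y = \<pi> z" using RX by (metis E.proj F.proj subsetD)
      then have "y = z" using t R(3) by (auto dest: inj_onD)
      moreover have "(y, a, b) \<in> O'" using t R V WN by blast
      ultimately show "t \<in> ?s ` O'" using t(1) by force
    qed
    ultimately show "\<exists>T. openin (vb_total (E \<oplus>\<^sub>V F)) T \<and> e \<in> T \<and> T \<subseteq> ?s ` O'" by blast
  qed
  then have op: "open_map ?X (vb_total (E \<oplus>\<^sub>V F)) ?s"
    by (simp add: open_map_def)
  have onto: "?s ` (topspace X \<times> UNIV) = topspace (vb_total (E \<oplus>\<^sub>V F))"
  proof
    show "?s ` (topspace X \<times> UNIV) \<subseteq> topspace (vb_total (E \<oplus>\<^sub>V F))"
      using E.q_in_total F.q_in_total by (auto simp: whitney_sum_def E.proj F.proj)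
    show "topspace (vb_total (E \<oplus>\<^sub>V F)) \<subseteq> ?s ` (topspace X \<times> UNIV)"
    proof
      fix t assume "t \<in> topspace (vb_total (E \<oplus>\<^sub>V F))"
      then obtain e f where t: "t = (e, f)" "e \<in> topspace (vb_total E)" "f \<in> topspace (vb_total F)"
        "vb_proj E e = vb_proj F f" by (auto simp: whitney_sum_def)
      obtain x v where x: "x \<in> topspace X" "e = q (x, v)" using E.total_cases[OF t(2)] .
      have "vb_proj F f = \<pi> x" using t(4) x E.proj by simp
      then obtain w where "f = r (x, w)" using F.total_at[OF t(3) x(1)] by blast
      then show "t \<in> ?s ` (topspace X \<times> UNIV)"
        using t(1) x by (intro image_eqI[of _ _ "(x, v, w)"]) auto
    qed
  qed
  show ?thesis
  proof
    show "\<exists>w'. ?s (y, v) = ?s (x, w')" if xy: "x \<in> topspace X" "y \<in> topspace X" "\<pi> x = \<pi> y" for x y v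
    proof -
      obtain a where "q (y, fst v) = q (x, a)" using E.transport[OF xy] by blast
      moreover obtain b where "r (y, snd v) = r (x, b)" using F.transport[OF xy] by blast
      ultimately show ?thesis by (intro exI[of _ "(a, b)"]) (simp add: case_prod_unfold)
    qed
    show "v = w" if "x \<in> topspace X" "?s (x, v) = ?s (x, w)" for x v w
      using that E.q_inj F.q_inj by (auto simp: case_prod_unfold prod_eq_iff)
  qed (use cont op onto in \<open>auto simp: whitney_sum_def E.base F.base E.proj E.add F.add E.scale F.scale\<close>)
qed

section \<open>Smooth maps\<close>

lemma C_k_on_subset: "C_k_on k f W \<Longrightarrow> V \<subseteq> W \<Longrightarrow> C_k_on k f V"
  by (induction k arbitrary: f) (auto intro: continuous_on_subset)

lemma C_k_on_cong:
  assumes "open W" "\<And>x. x \<in> W \<Longrightarrow> f x = g x" "C_k_on k f W"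
  shows "C_k_on k g W"
  using assms(2,3)
proof (induction k arbitrary: f g)
  case 0
  then show ?case by (auto cong: continuous_on_cong)
next
  case (Suc k)
  have diff: "f differentiable at x" if "x \<in> W" for x using Suc.prems(2) that by simp
  have "g differentiable at x" if "x \<in> W" for x
    using has_derivative_transform_within_open[OF _ assms(1) that, of f _ UNIV g] Suc.prems(1)
      diff[OF that] unfolding differentiable_def by blast
  moreover have "frechet_derivative f (at x) v = frechet_derivative g (at x) v" if "x \<in> W" for x v
    using frechet_derivative_transform_within_open[OF diff[OF that] assms(1) that, of g] Suc.prems(1) by simp
  then have "C_k_on k (\<lambda>x. frechet_derivative g (at x) v) W" for v
    using Suc.IH[of "\<lambda>x. frechet_derivative f (at x) v"] Suc.prems(2) by simp
  ultimately show ?case by simp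
qed

text \<open>Allows explicit derivative formulas in place of \<open>frechet_derivative\<close>; on an
  open set the two agree, and \<open>C_k_on_cong\<close> carries regularity across.\<close>

lemma C_k_on_Suc_I:
  assumes "open W" "\<And>x. x \<in> W \<Longrightarrow> (f has_derivative f' x) (at x)" "\<And>v. C_k_on k (\<lambda>x. f' x v) W"
  shows "C_k_on (Suc k) f W"
proof -
  have "f' x v = frechet_derivative f (at x) v" if "x \<in> W" for x v
    using frechet_derivative_at[OF assms(2)[OF that]] by simp
  then have "C_k_on k (\<lambda>x. frechet_derivative f (at x) v) W" for v
    by (rule C_k_on_cong[OF assms(1) _ assms(3)])
  then show ?thesis using assms(2) by (auto simp: differentiable_def)
qed

lemma C_k_on_SucD: "C_k_on (Suc k) f W \<Longrightarrow> C_k_on k f W"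
proof (induction k arbitrary: f)
  case 0
  then show ?case
    by (auto intro!: continuous_at_imp_continuous_on differentiable_imp_continuous_within)
next
  case (Suc k)
  have "C_k_on k (\<lambda>x. frechet_derivative f (at x) v) W" for v
    \<comment> \<open>The equation is instantiated so that only the outer layer unfolds and the
      derivative's own \<open>C_k_on (Suc k)\<close> stays intact for the induction
      hypothesis.\<close>
    by (rule Suc.IH) (use Suc.prems in \<open>unfold C_k_on.simps(2)[of "Suc k"], blast\<close>)
  then show ?case using Suc.prems by simp
qed

lemma C_k_on_const: "C_k_on k (\<lambda>x. c) W"
  by (induction k arbitrary: c) simp_all

lemma C_k_on_bounded_linear: "bounded_linear f \<Longrightarrow> C_k_on k f W"
proof (cases k)
  case (Suc j)
  assume f: "bounded_linear f"
  have "frechet_derivative f (at x) = f" for x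
    using frechet_derivative_at[OF bounded_linear_imp_has_derivative[OF f]] by simp
  then show ?thesis
    using f by (simp add: Suc C_k_on_const bounded_linear_imp_differentiable)
qed (simp add: linear_continuous_on)

lemma has_derivative_of_C_k_on:
  "C_k_on (Suc k) f W \<Longrightarrow> x \<in> W \<Longrightarrow> (f has_derivative frechet_derivative f (at x)) (at x)"
  using frechet_derivative_works by auto

lemma C_k_on_add:
  "open W \<Longrightarrow> C_k_on k f W \<Longrightarrow> C_k_on k g W \<Longrightarrow> C_k_on k (\<lambda>x. f x + g x) W"
proof (induction k arbitrary: f g)
  case (Suc k)
  show ?case
  proof (rule C_k_on_Suc_I[OF Suc.prems(1)])
    show "((\<lambda>x. f x + g x) has_derivative
      (\<lambda>v. frechet_derivative f (at x) v + frechet_derivative g (at x) v)) (at x)" if "x \<in> W" for x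
      by (intro has_derivative_add has_derivative_of_C_k_on[OF _ that, of k] Suc.prems)
    show "C_k_on k (\<lambda>x. frechet_derivative f (at x) v + frechet_derivative g (at x) v) W" for v
      using Suc.prems by (intro Suc.IH) simp_all
  qed
qed (simp add: continuous_on_add)

text \<open>One Leibniz induction serves real products, scalar multiplication and the inner product.
  The derivative still contains undifferentiated factors, whose lower regularity comes from
  \<open>C_k_on_SucD\<close>.\<close>

lemma C_k_on_bilinear:
  assumes "bounded_bilinear pr" "open W"
  shows "C_k_on k f W \<Longrightarrow> C_k_on k g W \<Longrightarrow> C_k_on k (\<lambda>x. pr (f x) (g x)) W"
proof (induction k arbitrary: f g)
  case 0
  then show ?case by (simp add: bounded_bilinear.continuous_on[OF assms(1)])
next
  case (Suc k)
  note fg = Suc.prems[THEN C_k_on_SucD]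
  show ?case
  proof (rule C_k_on_Suc_I[OF assms(2)])
    show "((\<lambda>x. pr (f x) (g x)) has_derivative
        (\<lambda>v. pr (f x) (frechet_derivative g (at x) v) + pr (frechet_derivative f (at x) v) (g x)))
        (at x)" if "x \<in> W" for x
      by (intro bounded_bilinear.FDERIV[OF assms(1)] has_derivative_of_C_k_on[OF _ that, of k] Suc.prems)
    show "C_k_on k (\<lambda>x. pr (f x) (frechet_derivative g (at x) v) +
        pr (frechet_derivative f (at x) v) (g x)) W" for v
      using Suc.prems fg by (intro C_k_on_add assms(2) Suc.IH) simp_all
  qed
qed

lemma C_k_on_bounded_linear_compose:
  assumes "bounded_linear L" "open W"
  shows "C_k_on k f W \<Longrightarrow> C_k_on k (\<lambda>x. L (f x)) W"
proof (induction k arbitrary: f)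
  case 0
  then show ?case by (simp add: bounded_linear.continuous_on[OF assms(1)])
next
  case (Suc k)
  show ?case
  proof (rule C_k_on_Suc_I[OF assms(2)])
    show "((\<lambda>x. L (f x)) has_derivative (\<lambda>v. L (frechet_derivative f (at x) v))) (at x)"
      if "x \<in> W" for x
      by (intro bounded_linear.has_derivative[OF assms(1)] has_derivative_of_C_k_on[OF _ that, of k] Suc.prems)
    show "C_k_on k (\<lambda>x. L (frechet_derivative f (at x) v)) W" for v
      using Suc.prems by (intro Suc.IH) simp
  qed
qed

text \<open>Differentiation lowers the exponent by one, so the induction runs over all real
  exponents \<open>a\<close> at once; the square root is the instance \<open>1/2\<close>.\<close>

lemma C_k_on_powr:
  fixes f :: "'a::euclidean_space \<Rightarrow> real"
  assumes "open W" "\<And>x. x \<in> W \<Longrightarrow> f x > 0"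
  shows "C_k_on k f W \<Longrightarrow> C_k_on k (\<lambda>x. f x powr a) W"
proof (induction k arbitrary: a)
  case 0
  then show ?case using assms(2) by (force intro!: continuous_intros)
next
  case (Suc k)
  note f = Suc.prems[THEN C_k_on_SucD]
  show ?case
  proof (rule C_k_on_Suc_I[OF assms(1)])
    show "((\<lambda>x. f x powr a) has_derivative
        (\<lambda>v. frechet_derivative f (at x) v * (a * f x powr (a - 1)))) (at x)" if "x \<in> W" for x
      using DERIV_compose_FDERIV[OF has_real_derivative_powr[OF assms(2)[OF that]]
          has_derivative_of_C_k_on[OF Suc.prems that]] .
    show "C_k_on k (\<lambda>x. frechet_derivative f (at x) v * (a * f x powr (a - 1))) W" for v
      using Suc.prems f
      by (intro C_k_on_bilinear[OF bounded_bilinear_mult assms(1)] C_k_on_const Suc.IH) simp_all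
  qed
qed

section \<open>From local smooth extensions to continuous derivatives\<close>

lemma continuous_on_locally:
  assumes "\<And>x. x \<in> S \<Longrightarrow> \<exists>N. open N \<and> x \<in> N \<and> continuous_on (S \<inter> N) f"
  shows "continuous_on S f"
  unfolding continuous_on_def
proof
  fix x assume x: "x \<in> S"
  then obtain N where N: "open N" "x \<in> N" "continuous_on (S \<inter> N) f" using assms by blast
  have "at x within S = at x within S \<inter> N" by (rule at_within_nhd[OF N(2,1)]) auto
  then show "(f \<longlongrightarrow> f x) (at x within S)"
    using N x by (auto simp: continuous_on_def)
qed

lemma smooth_on_imp_continuous_on:
  assumes "smooth_on S f"
  shows "continuous_on S f"
proof (rule continuous_on_locally)
  fix x assume "x \<in> S"
  then obtain W F where W: "open W" "x \<in> W" "\<forall>k. C_k_on k F W" "\<forall>y\<in>S \<inter> W. F y = f y"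
    using assms unfolding smooth_on_def by blast
  have "continuous_on W F" using W(3) C_k_on.simps(1) by blast
  then have "continuous_on (S \<inter> W) F" by (rule continuous_on_subset) simp
  then have "continuous_on (S \<inter> W) f" using W(4) by (intro continuous_on_eq[of "S \<inter> W" F f]) auto
  then show "\<exists>N. open N \<and> x \<in> N \<and> continuous_on (S \<inter> N) f" using W by blast
qed

text \<open>On an open set the local extensions agree with \<open>f\<close> near each point and so
  have its derivatives. First order is all that tangent vectors require.\<close>

lemma smooth_on_open_imp_C1:
  assumes "smooth_on S f" "open S"
  shows "C_k_on (Suc 0) f S"
proof -
  have loc: "\<exists>V. open V \<and> x \<in> V \<and> C_k_on (Suc 0) f V" if "x \<in> S" for x
  proof -
    obtain W F where W: "open W" "x \<in> W" "\<forall>k. C_k_on k F W" "\<forall>y\<in>S \<inter> W. F y = f y"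
      using assms(1) \<open>x \<in> S\<close> unfolding smooth_on_def by blast
    have "C_k_on (Suc 0) F (S \<inter> W)" using W(3) C_k_on_subset by blast
    then have "C_k_on (Suc 0) f (S \<inter> W)"
      using W(4) assms(2) W(1) by (intro C_k_on_cong[of "S \<inter> W" F f]) auto
    then show ?thesis using W(1,2) assms(2) \<open>x \<in> S\<close> by (intro exI[of _ "S \<inter> W"]) auto
  qed
  have "continuous_on S (\<lambda>x. frechet_derivative f (at x) v)" for v
  proof (rule continuous_on_locally)
    fix x assume "x \<in> S"
    with loc obtain V where V: "open V" "x \<in> V" "C_k_on (Suc 0) f V" by blast
    then have "continuous_on (S \<inter> V) (\<lambda>x. frechet_derivative f (at x) v)"
      by (auto intro: continuous_on_subset)
    with V show "\<exists>N. open N \<and> x \<in> N \<and> continuous_on (S \<inter> N) (\<lambda>x. frechet_derivative f (at x) v)"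
      by blast
  qed
  moreover have "f differentiable at x" if "x \<in> S" for x using loc[OF that] by auto
  ultimately show ?thesis by simp
qed

text \<open>\<open>C_k_on\<close> controls a derivative one direction at a time, whereas the total
  space needs joint continuity in point and vector. Expanding the vector in the finite basis bridges
  the gap.\<close>

lemma continuous_on_linear_family:
  fixes f :: "'a::topological_space \<Rightarrow> 'b::euclidean_space \<Rightarrow> 'c::real_normed_vector"
  assumes "\<And>x. x \<in> S \<Longrightarrow> linear (f x)" "\<And>v. continuous_on S (\<lambda>x. f x v)"
  shows "continuous_on (S \<times> UNIV) (\<lambda>(x, v). f x v)"
proof -
  have "continuous_on (S \<times> UNIV) (\<lambda>z. \<Sum>i\<in>Basis. (snd z \<bullet> i) *\<^sub>R f (fst z) i)"
    by (intro continuous_intros continuous_on_compose2[OF assms(2) continuous_on_fst]) auto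
  moreover have "(\<Sum>i\<in>Basis. (v \<bullet> i) *\<^sub>R f x i) = f x v" if "x \<in> S" for x v
  proof -
    have "f x v = f x (\<Sum>i\<in>Basis. (v \<bullet> i) *\<^sub>R i)" by (simp add: euclidean_representation)
    then show ?thesis using assms(1)[OF that] by (simp add: linear_sum linear_cmul)
  qed
  ultimately show ?thesis by - (erule continuous_on_eq, auto)
qed

lemma continuous_on_frechet_derivative:
  fixes f :: "'a::euclidean_space \<Rightarrow> 'b::real_normed_vector"
  assumes "C_k_on (Suc 0) f W"
  shows "continuous_on (W \<times> UNIV) (\<lambda>(x, v). frechet_derivative f (at x) v)"
  using assms by (intro continuous_on_linear_family linear_frechet_derivative) auto

section \<open>Charts of the unit sphere\<close>

text \<open>Here \<open>sgn z\<close> is \<open>z / norm z\<close>, the radial retraction onto the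
  sphere; differentiating the quotient at a unit vector yields the orthogonal projection onto the
  tangent space.\<close>

lemma has_derivative_sgn:
  fixes x :: "'a::real_inner"
  assumes "norm x = 1"
  shows "(sgn has_derivative (\<lambda>u. u - (x \<bullet> u) *\<^sub>R x)) (at x)"
proof -
  have "x \<noteq> 0" using assms by auto
  then have "((\<lambda>z. inverse (norm z) *\<^sub>R z) has_derivative (\<lambda>u. u - (x \<bullet> u) *\<^sub>R x)) (at x)"
    using assms by (auto intro!: derivative_eq_intros has_derivative_norm
        simp: sgn_div_norm inner_commute)
  then show ?thesis by (simp add: sgn_div_norm[abs_def])
qed

text \<open>Turns a relatively open piece of the sphere into an ambient neighbourhood, on which
  identities precomposed with \<open>sgn\<close> can be differentiated. The retraction is continuous
  away from \<open>0\<close>.\<close>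

lemma sphere_nbhd_sgn:
  fixes x :: "'a::euclidean_space"
  assumes "openin (top_of_set (sphere 0 1)) W" "x \<in> W"
  obtains N where "open N" "x \<in> N" "\<And>z. z \<in> N \<Longrightarrow> sgn z \<in> W"
proof -
  obtain O' where O': "open O'" "W = sphere 0 1 \<inter> O'" using assms(1) openin_open by blast
  have "open (- {0} \<inter> sgn -` O')"
    by (rule continuous_open_preimage) (auto intro!: continuous_on_sgn continuous_on_id O')
  moreover have "x \<in> - {0} \<inter> sgn -` O'" using assms(2) O' by (auto simp: sgn_div_norm)
  moreover have "sgn z \<in> W" if "z \<in> - {0} \<inter> sgn -` O'" for z
    using that O' by (auto simp: norm_sgn)
  ultimately show thesis using that by blast
qed

text \<open>The values of \<open>\<psi>\<close> off the sphere are arbitrary, so it has no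
  meaningful ambient derivative; \<open>\<psi> \<circ> sgn\<close> is the extension constant along
  rays.\<close>

definition radial_deriv :: "('a::euclidean_space \<Rightarrow> 'm::euclidean_space) \<Rightarrow> 'a \<Rightarrow> 'a \<Rightarrow> 'm" where
  "radial_deriv \<psi> x = frechet_derivative (\<psi> \<circ> sgn) (at x)"

locale sphere_chart =
  fixes W :: "'a::euclidean_space set" and \<psi> :: "'a \<Rightarrow> 'm::euclidean_space"
  assumes atlas: "(W, \<psi>) \<in> submanifold_atlas (sphere 0 1)"
begin

definition \<theta> where "\<theta> = inv_into W \<psi>"

text \<open>Indexed by the point of the sphere instead of its coordinates, so that it pairs with
  \<open>radial_deriv \<psi> x\<close> as an inverse.\<close>

definition D\<theta> where "D\<theta> x = frechet_derivative \<theta> (at (\<psi> x))"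

lemma openin_W: "openin (top_of_set (sphere 0 1)) W"
  and open_image: "open (\<psi> ` W)"
  and smooth: "smooth_on W \<psi>"
  and smooth_inv: "smooth_on (\<psi> ` W) \<theta>"
  using atlas by (auto simp: submanifold_atlas_def topological_chart_def \<theta>_def)

lemma inj: "inj_on \<psi> W"
proof -
  have "homeomorphic_map (top_of_set W) (top_of_set (\<psi> ` W)) \<psi>"
    using atlas openin_imp_subset[OF openin_W]
    by (auto simp: submanifold_atlas_def topological_chart_def subtopology_subtopology inf.absorb2)
  then show ?thesis using homeomorphic_imp_injective_map by fastforce
qed

lemma theta_psi: "x \<in> W \<Longrightarrow> \<theta> (\<psi> x) = x"
  using inj by (simp add: \<theta>_def)

lemma W_norm: "x \<in> W \<Longrightarrow> norm x = 1"
  using openin_imp_subset[OF openin_W] by auto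

lemma W_sgn: "x \<in> W \<Longrightarrow> sgn x = x"
  by (simp add: W_norm sgn_div_norm)

lemma theta_C1: "C_k_on (Suc 0) \<theta> (\<psi> ` W)"
  using smooth_on_open_imp_C1[OF smooth_inv open_image] .

lemma theta_has_derivative: "x \<in> W \<Longrightarrow> (\<theta> has_derivative D\<theta> x) (at (\<psi> x))"
  unfolding D\<theta>_def by (rule has_derivative_of_C_k_on[OF theta_C1]) simp

text \<open>Near \<open>z\<close> the maps \<open>\<psi> \<circ> sgn\<close> and
  \<open>F \<circ> sgn\<close> coincide, so the chain rule applies to the smooth extension
  \<open>F\<close>. The formula holds for all \<open>z\<close> near \<open>x\<close> with one
  \<open>F\<close>, which later gives continuity of the derivative in \<open>z\<close>.\<close>

lemma local_extension:
  assumes "x \<in> W"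
  obtains N F where "open N" "x \<in> N" "C_k_on (Suc 0) F N"
    "\<And>z. z \<in> W \<inter> N \<Longrightarrow> (\<psi> \<circ> sgn has_derivative
      (\<lambda>u. frechet_derivative F (at z) (u - (z \<bullet> u) *\<^sub>R z))) (at z)"
proof -
  obtain N F where N: "open N" "x \<in> N" "\<forall>k. C_k_on k F N" "\<forall>y\<in>W \<inter> N. F y = \<psi> y"
    using smooth assms unfolding smooth_on_def by blast
  have C1: "C_k_on (Suc 0) F N" using N(3) by blast
  have "(\<psi> \<circ> sgn has_derivative (\<lambda>u. frechet_derivative F (at z) (u - (z \<bullet> u) *\<^sub>R z))) (at z)"
    if z: "z \<in> W \<inter> N" for z
  proof -
    have "openin (top_of_set (sphere 0 1)) (W \<inter> N)"
      using openin_W N(1) by (metis openin_Int_open)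
    then obtain V where V: "open V" "z \<in> V" "\<And>y. y \<in> V \<Longrightarrow> sgn y \<in> W \<inter> N"
      using sphere_nbhd_sgn z by metis
    have "(sgn has_derivative (\<lambda>u. u - (z \<bullet> u) *\<^sub>R z)) (at z)"
      using z by (intro has_derivative_sgn W_norm) simp
    moreover have "(F has_derivative frechet_derivative F (at z)) (at (sgn z))"
      using z W_sgn has_derivative_of_C_k_on[OF C1, of z] by simp
    ultimately have "(F \<circ> sgn has_derivative frechet_derivative F (at z) \<circ> (\<lambda>u. u - (z \<bullet> u) *\<^sub>R z)) (at z)"
      by (rule diff_chain_at)
    then have "(\<psi> \<circ> sgn has_derivative frechet_derivative F (at z) \<circ> (\<lambda>u. u - (z \<bullet> u) *\<^sub>R z)) (at z)"
      by (rule has_derivative_transform_within_open[OF _ V(1,2)]) (use V(3) N(4) in simp)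
    then show ?thesis by (simp add: o_def)
  qed
  with that N C1 show thesis by blast
qed

lemma radial_has_derivative:
  assumes "x \<in> W"
  shows "(\<psi> \<circ> sgn has_derivative radial_deriv \<psi> x) (at x)"
proof -
  obtain D where "(\<psi> \<circ> sgn has_derivative D) (at x)"
    using local_extension[OF assms] assms by (metis IntI)
  then show ?thesis
    unfolding radial_deriv_def using frechet_derivative_at by metis
qed

lemma linear_radial: "x \<in> W \<Longrightarrow> linear (radial_deriv \<psi> x)"
  using radial_has_derivative has_derivative_linear by blast

lemma continuous_on_radial: "continuous_on (W \<times> UNIV) (\<lambda>(x, u). radial_deriv \<psi> x u)"
proof (rule continuous_on_locally, clarify)
  fix x u assume "x \<in> W"
  then obtain N F where N: "open N" "x \<in> N" "C_k_on (Suc 0) F N"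
    and F: "\<And>z. z \<in> W \<inter> N \<Longrightarrow> (\<psi> \<circ> sgn has_derivative
      (\<lambda>u. frechet_derivative F (at z) (u - (z \<bullet> u) *\<^sub>R z))) (at z)"
    using local_extension by metis
  have "radial_deriv \<psi> z u = frechet_derivative F (at z) (u - (z \<bullet> u) *\<^sub>R z)" if "z \<in> W \<inter> N" for z u
    unfolding radial_deriv_def using frechet_derivative_at[OF F[OF that]] by metis
  moreover have "continuous_on ((W \<inter> N) \<times> UNIV)
      (\<lambda>z. frechet_derivative F (at (fst z)) (snd z - (fst z \<bullet> snd z) *\<^sub>R fst z))"
  proof -
    let ?p = "\<lambda>z. (fst z, snd z - (fst z \<bullet> snd z) *\<^sub>R fst z)"
    have "continuous_on ((W \<inter> N) \<times> UNIV) (\<lambda>z. case ?p z of (x, v) \<Rightarrow> frechet_derivative F (at x) v)"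
      by (rule continuous_on_compose2[OF continuous_on_frechet_derivative[OF N(3)]])
        (intro continuous_intros, auto)
    then show ?thesis by simp
  qed
  ultimately have "continuous_on ((W \<inter> N) \<times> UNIV) (\<lambda>(x, u). radial_deriv \<psi> x u)"
    by - (erule continuous_on_eq, auto)
  then show "\<exists>M. open M \<and> (x, u) \<in> M \<and>
      continuous_on (W \<times> UNIV \<inter> M) (\<lambda>(x, u). radial_deriv \<psi> x u)"
    using N(1,2) by (intro exI[of _ "N \<times> UNIV"]) (simp add: Times_Int_Times open_Times)
qed

lemma continuous_on_D\<theta>: "continuous_on (W \<times> UNIV) (\<lambda>(x, v). D\<theta> x v)"
proof -
  have "continuous_on (W \<times> (UNIV :: 'm set)) (\<lambda>z. (\<psi> (fst z), snd z))"
    by (intro continuous_on_Pair continuous_on_snd continuous_on_id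
        continuous_on_compose2[OF smooth_on_imp_continuous_on[OF smooth] continuous_on_fst]) auto
  then have "continuous_on (W \<times> UNIV) (\<lambda>z. case (\<psi> (fst z), snd z) of
      (y, v) \<Rightarrow> frechet_derivative \<theta> (at y) v)"
    by (rule continuous_on_compose2[OF continuous_on_frechet_derivative[OF theta_C1]]) auto
  then show ?thesis by (simp add: D\<theta>_def case_prod_unfold)
qed

text \<open>Since \<open>\<theta>\<close> lands on the sphere, where \<open>sgn\<close> is the
  identity, \<open>f\<close> is the radial extension of \<open>\<phi>\<close> composed with
  \<open>\<theta>\<close>. Taking \<open>f\<close> to be the identity inverts a chart; taking a
  transition map computes its derivative.\<close>

lemma deriv_in_chart:
  assumes "x \<in> W" "(\<phi> \<circ> sgn has_derivative radial_deriv \<phi> x) (at x)"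
    and "\<And>y. y \<in> \<psi> ` W \<Longrightarrow> \<phi> (\<theta> y) = f y"
  shows "(f has_derivative radial_deriv \<phi> x \<circ> D\<theta> x) (at (\<psi> x))"
proof -
  have "((\<phi> \<circ> sgn) \<circ> \<theta> has_derivative radial_deriv \<phi> x \<circ> D\<theta> x) (at (\<psi> x))"
    by (rule diff_chain_at) (use assms theta_has_derivative theta_psi in auto)
  then show ?thesis
    by (rule has_derivative_transform_within_open[OF _ open_image])
      (use assms(1) assms(3)[OF imageI] in \<open>auto simp: theta_psi W_sgn\<close>)
qed

lemma radial_D\<theta>:
  assumes "x \<in> W"
  shows "radial_deriv \<psi> x (D\<theta> x v) = v"
proof -
  have "((\<lambda>y. y) has_derivative radial_deriv \<psi> x \<circ> D\<theta> x) (at (\<psi> x))"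
    by (rule deriv_in_chart[OF assms radial_has_derivative[OF assms]]) (auto simp: theta_psi)
  then have "radial_deriv \<psi> x \<circ> D\<theta> x = (\<lambda>y. y)"
    using has_derivative_unique has_derivative_ident by blast
  then show ?thesis by (metis comp_apply)
qed

text \<open>Differentiate \<open>\<theta> \<circ> (\<psi> \<circ> sgn) = sgn\<close>, valid near
  \<open>x\<close>, and compare with the known derivative of \<open>sgn\<close>.\<close>

lemma D\<theta>_radial:
  assumes "x \<in> W"
  shows "D\<theta> x (radial_deriv \<psi> x u) = u - (x \<bullet> u) *\<^sub>R x"
proof -
  obtain N where N: "open N" "x \<in> N" "\<And>z. z \<in> N \<Longrightarrow> sgn z \<in> W"
    using sphere_nbhd_sgn[OF openin_W assms] by blast
  have "(\<theta> \<circ> (\<psi> \<circ> sgn) has_derivative D\<theta> x \<circ> radial_deriv \<psi> x) (at x)"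
    by (rule diff_chain_at)
      (use assms theta_has_derivative radial_has_derivative W_sgn in auto)
  then have "(sgn has_derivative D\<theta> x \<circ> radial_deriv \<psi> x) (at x)"
    by (rule has_derivative_transform_within_open[OF _ N(1,2)]) (use N(3) theta_psi in auto)
  then have "D\<theta> x \<circ> radial_deriv \<psi> x = (\<lambda>u. u - (x \<bullet> u) *\<^sub>R x)"
    using has_derivative_unique has_derivative_sgn[OF W_norm[OF assms]] by blast
  then show ?thesis by (metis comp_apply)
qed

lemma D\<theta>_orthogonal:
  assumes "x \<in> W"
  shows "x \<bullet> D\<theta> x v = 0"
proof -
  \<comment> \<open>Inserting \<open>D\<theta> x v\<close> into the projection formula shows that it
    is fixed by the projection onto the tangent space.\<close>
  have "D\<theta> x v = D\<theta> x v - (x \<bullet> D\<theta> x v) *\<^sub>R x"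
    using D\<theta>_radial[OF assms, of "D\<theta> x v"] radial_D\<theta>[OF assms] by simp
  moreover have "x \<noteq> 0" using W_norm[OF assms] by auto
  ultimately show ?thesis by simp
qed

lemma radial_self:
  assumes "x \<in> W"
  shows "radial_deriv \<psi> x x = 0"
proof -
  have "D\<theta> x (radial_deriv \<psi> x x) = 0"
    using D\<theta>_radial[OF assms, of x] W_norm[OF assms] by (simp flip: power2_norm_eq_inner)
  then show ?thesis
    using radial_D\<theta>[OF assms, of "radial_deriv \<psi> x x"] linear_0[OF linear_radial[OF assms]] by simp
qed

end

lemma submanifold_atlasI:
  assumes "openin (top_of_set S) W" "inj_on \<psi> W" "open (\<psi> ` W)"
    and "smooth_on W \<psi>" "smooth_on (\<psi> ` W) (inv_into W \<psi>)"
  shows "(W, \<psi>) \<in> submanifold_atlas S"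
proof -
  have "homeomorphic_maps (top_of_set W) (top_of_set (\<psi> ` W)) \<psi> (inv_into W \<psi>)"
    using assms(2) smooth_on_imp_continuous_on[OF assms(4)] smooth_on_imp_continuous_on[OF assms(5)]
    by (auto simp: homeomorphic_maps_def continuous_map_in_subtopology inv_into_into f_inv_into_f)
  then have "homeomorphic_map (top_of_set W) (top_of_set (\<psi> ` W)) \<psi>"
    by (rule homeomorphic_maps_imp_map)
  then show ?thesis
    using assms openin_imp_subset[OF assms(1)]
    by (auto simp: submanifold_atlas_def topological_chart_def subtopology_subtopology inf.absorb2)
qed

text \<open>Orthogonal projection onto the hyperplane \<open>x\<^sup>\<bottom>\<close>, identified with the model space by an
  isometry with inverse \<open>S\<close>, is inverted by \<open>y \<mapsto> S y + sqrt (1 - norm (S y)\<^sup>2) x\<close>.\<close>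

lemma sphere_projection_chart:
  fixes x :: "'a::euclidean_space"
  assumes "norm x = 1" "DIM('a) = Suc DIM('m::euclidean_space)"
  obtains T :: "'a \<Rightarrow> 'm::euclidean_space" and D \<kappa> where "linear T" "open D" "\<And>k. C_k_on k \<kappa> D"
    "\<And>z. norm z = 1 \<Longrightarrow> x \<bullet> z > 0 \<Longrightarrow> T z \<in> D \<and> \<kappa> (T z) = z"
    "\<And>y. y \<in> D \<Longrightarrow> norm (\<kappa> y) = 1 \<and> T (\<kappa> y) = y"
proof -
  let ?H = "{u. x \<bullet> u = 0}"
  have xx: "x \<bullet> x = 1" using assms(1) by (simp flip: power2_norm_eq_inner)
  have "x \<noteq> 0" using assms(1) by auto
  then have dim: "dim ?H = dim (UNIV :: 'm set)" using assms(2) by (simp add: dim_hyperplane)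
  obtain f :: "'a \<Rightarrow> 'm" and S where f: "linear f" "linear S" "f ` ?H = UNIV" "S ` UNIV = ?H"
    "\<And>u. u \<in> ?H \<Longrightarrow> norm (f u) = norm u" "\<And>y. y \<in> UNIV \<Longrightarrow> norm (S y) = norm y"
    "\<And>u. u \<in> ?H \<Longrightarrow> S (f u) = u" "\<And>y. y \<in> UNIV \<Longrightarrow> f (S y) = y"
    by (rule isometries_subspaces[OF subspace_hyperplane subspace_UNIV dim]) blast
  define T where "T = (\<lambda>u. f (u - (x \<bullet> u) *\<^sub>R x))"
  define D where "D = {y. (S y) \<bullet> (S y) < 1}"
  \<comment> \<open>The root is written as a power, and the norm as an inner product, to fit
    \<open>C_k_on_powr\<close> and \<open>C_k_on_bilinear\<close>.\<close>
  define \<kappa> where "\<kappa> = (\<lambda>y. S y + ((1 - S y \<bullet> S y) powr (1/2)) *\<^sub>R x)"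
  have "linear (\<lambda>u. u - (x \<bullet> u) *\<^sub>R x)"
    by (rule linearI) (simp_all add: inner_add_right algebra_simps)
  then have linT: "linear T"
    unfolding T_def using linear_compose[OF _ f(1)] by (simp add: o_def)
  have xS: "x \<bullet> S y = 0" for y using f(4) by auto
  have blS: "bounded_linear S" using f(2) by (simp add: linear_conv_bounded_linear)
  have contS: "continuous_on UNIV S" using blS by (rule linear_continuous_on)
  have openD: "open D"
    unfolding D_def by (rule open_Collect_less[OF continuous_on_inner[OF contS contS] continuous_on_const])
  have smooth\<kappa>: "C_k_on k \<kappa> D" for k
  proof -
    have 1: "C_k_on k S D" using blS by (rule C_k_on_bounded_linear)
    then have "C_k_on k (\<lambda>y. S y \<bullet> S y) D"
      by (intro C_k_on_bilinear[OF bounded_bilinear_inner openD])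
    then have "C_k_on k (\<lambda>y. 1 + (- (S y \<bullet> S y))) D"
      by (intro C_k_on_add openD C_k_on_const C_k_on_bounded_linear_compose[OF bounded_linear_minus[OF bounded_linear_ident]])
    then have "C_k_on k (\<lambda>y. (1 + (- (S y \<bullet> S y))) powr (1/2)) D"
      by (intro C_k_on_powr openD) (auto simp: D_def)
    then show ?thesis
      unfolding \<kappa>_def using 1 C_k_on_const[of k x D]
      by (intro C_k_on_add openD C_k_on_bilinear[OF bounded_bilinear_scaleR openD]) auto
  qed
  have ST: "S (T z) = z - (x \<bullet> z) *\<^sub>R x" for z
    unfolding T_def using xx by (intro f(7)) (simp add: inner_diff_right)
  have left: "T z \<in> D \<and> \<kappa> (T z) = z" if z: "norm z = 1" "x \<bullet> z > 0" for z
  proof -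
    have zz: "z \<bullet> z = 1" using z(1) by (simp flip: power2_norm_eq_inner)
    \<comment> \<open>Hence the root in \<open>\<kappa> (T z)\<close> is that of
      \<open>(x \<bullet> z)\<^sup>2\<close>; positivity of \<open>x \<bullet> z\<close> selects the
      hemisphere and makes it \<open>x \<bullet> z\<close>.\<close>
    have "S (T z) \<bullet> S (T z) = 1 - (x \<bullet> z)\<^sup>2"
      unfolding ST using zz xx by (simp add: algebra_simps inner_commute power2_eq_square)
    then show ?thesis
      using z(2) by (simp add: D_def \<kappa>_def powr_half_sqrt) (simp add: ST)
  qed
  have right: "norm (\<kappa> y) = 1 \<and> T (\<kappa> y) = y" if y: "y \<in> D" for y
  proof
    define c where "c = (1 - S y \<bullet> S y) powr (1/2)"
    have "c\<^sup>2 = 1 - S y \<bullet> S y" using y by (simp add: c_def D_def powr_half_sqrt)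
    then have "\<kappa> y \<bullet> \<kappa> y = 1"
      unfolding \<kappa>_def c_def[symmetric] using xx xS[of y]
      by (simp add: algebra_simps inner_commute[of "S y" x] power2_eq_square)
    then show "norm (\<kappa> y) = 1" by (simp add: norm_eq_1)
    have "\<kappa> y - (x \<bullet> \<kappa> y) *\<^sub>R x = S y"
      using xx xS[of y] by (simp add: \<kappa>_def inner_add_right)
    then show "T (\<kappa> y) = y" by (simp add: T_def f(8))
  qed
  show thesis using that linT openD smooth\<kappa> left right by blast
qed

section \<open>Orbit maps\<close>

locale continuous_action = group G for G :: "('g, 'm) monoid_scheme" +
  fixes X :: "'a topology" and \<phi> :: "'g \<Rightarrow> 'a \<Rightarrow> 'a"
  assumes act_continuous: "g \<in> carrier G \<Longrightarrow> continuous_map X X (\<phi> g)"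
    and act_one: "x \<in> topspace X \<Longrightarrow> \<phi> \<one>\<^bsub>G\<^esub> x = x"
    and act_mult: "g \<in> carrier G \<Longrightarrow> h \<in> carrier G \<Longrightarrow> x \<in> topspace X \<Longrightarrow> \<phi> (g \<otimes>\<^bsub>G\<^esub> h) x = \<phi> g (\<phi> h x)"
begin

lemma act_closed: "g \<in> carrier G \<Longrightarrow> x \<in> topspace X \<Longrightarrow> \<phi> g x \<in> topspace X"
  using act_continuous continuous_map_image_subset_topspace by fastforce

lemma act_inv_cancel:
  assumes "g \<in> carrier G" "x \<in> topspace X"
  shows "\<phi> (inv\<^bsub>G\<^esub> g) (\<phi> g x) = x"
proof -
  have "\<phi> (inv\<^bsub>G\<^esub> g) (\<phi> g x) = \<phi> (inv\<^bsub>G\<^esub> g \<otimes>\<^bsub>G\<^esub> g) x"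
    by (rule act_mult[symmetric]) (use assms in auto)
  then show ?thesis using assms act_one by simp
qed

lemma orbit_act:
  assumes "g \<in> carrier G" "x \<in> topspace X"
  shows "orbit G \<phi> (\<phi> g x) = orbit G \<phi> x"
proof -
  have "\<phi> h x \<in> orbit G \<phi> (\<phi> g x)" if "h \<in> carrier G" for h
  proof -
    have "\<phi> (h \<otimes>\<^bsub>G\<^esub> inv\<^bsub>G\<^esub> g) (\<phi> g x) = \<phi> h x"
      using assms that by (simp add: act_mult act_closed act_inv_cancel)
    then show ?thesis
      unfolding orbit_def using assms that by (intro CollectI exI[of _ "h \<otimes>\<^bsub>G\<^esub> inv\<^bsub>G\<^esub> g"]) simp
  qed
  moreover have "\<phi> h (\<phi> g x) \<in> orbit G \<phi> x" if "h \<in> carrier G" for h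
    unfolding orbit_def using assms that by (intro CollectI exI[of _ "h \<otimes>\<^bsub>G\<^esub> g"]) (simp add: act_mult)
  ultimately show ?thesis by (auto simp: orbit_def)
qed

lemma orbit_self: "x \<in> topspace X \<Longrightarrow> x \<in> orbit G \<phi> x"
  unfolding orbit_def using act_one by (intro CollectI exI[of _ "\<one>\<^bsub>G\<^esub>"]) simp

lemma orbit_eq_iff:
  assumes "x \<in> topspace X" "y \<in> topspace X"
  shows "orbit G \<phi> x = orbit G \<phi> y \<longleftrightarrow> (\<exists>g\<in>carrier G. y = \<phi> g x)"
proof
  assume "orbit G \<phi> x = orbit G \<phi> y"
  then have "y \<in> orbit G \<phi> x" using orbit_self[OF assms(2)] by simp
  then show "\<exists>g\<in>carrier G. y = \<phi> g x" by (auto simp: orbit_def)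
qed (use assms orbit_act in auto)

lemma quotient_map_orbit: "quotient_map X (orbit_space G \<phi> X) (orbit G \<phi>)"
  unfolding orbit_space_def by (rule quotient_map_quotient_topology)

text \<open>The saturation of an open set is the union of its preimages under the maps
  \<open>\<phi> g\<close>, each of which is open.\<close>

lemma open_map_orbit: "open_map X (orbit_space G \<phi> X) (orbit G \<phi>)"
  unfolding open_map_def
proof (intro allI impI)
  fix U assume U: "openin X U"
  have UX: "U \<subseteq> topspace X" using U by (rule openin_subset)
  have "{x \<in> topspace X. orbit G \<phi> x \<in> orbit G \<phi> ` U} =
      (\<Union>g\<in>carrier G. {x \<in> topspace X. \<phi> g x \<in> U})" (is "?L = ?R")
  proof (rule Set.set_eqI, rule iffI)
    fix x assume "x \<in> ?L"
    then obtain y where "x \<in> topspace X" "y \<in> U" "orbit G \<phi> x = orbit G \<phi> y" by auto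
    then show "x \<in> ?R" using orbit_eq_iff[of x y] UX by auto
  next
    fix x assume "x \<in> ?R"
    then obtain g where "g \<in> carrier G" "x \<in> topspace X" "\<phi> g x \<in> U" by auto
    then show "x \<in> ?L" using orbit_act[of g x] by (auto intro: image_eqI[of _ _ "\<phi> g x"])
  qed
  moreover have "openin X ?R"
    by (intro openin_Union) (auto intro: openin_continuous_map_preimage[OF act_continuous U])
  ultimately show "openin (orbit_space G \<phi> X) (orbit G \<phi> ` U)"
    unfolding orbit_space_def openin_quotient_topology using UX by auto
qed

end

lemma prod_topology_top_of_set_euclidean:
  "prod_topology (top_of_set S) (euclidean :: 'b::topological_space topology) = top_of_set (S \<times> UNIV)"
  for S :: "'a::topological_space set"
  using prod_topology_subtopology_eu[of S "UNIV :: 'b set"] by (simp only: subtopology_UNIV)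

section \<open>The action of \<open>Q\<^sub>8\<close>\<close>

lemma qmult_diff_left: "(g - h) \<bullet>\<^sub>q p = g \<bullet>\<^sub>q p - h \<bullet>\<^sub>q p"
  by (simp add: qmult_def prod_eq_iff algebra_simps)

lemma norm_Q8: "g \<in> carrier Q8 \<Longrightarrow> norm g = 1"
  by (auto simp: Q8_def q1_def qi_def qj_def qk_def norm_Pair)

lemma norm_Q8_act: "norm (Q8_act g x) = norm g * norm x"
proof -
  have "(norm (Q8_act g x))\<^sup>2 = (norm g * norm x)\<^sup>2"
    by (simp add: Q8_act_def norm_prod_def[of x] norm_Pair norm_qmult power_mult_distrib algebra_simps)
  then show ?thesis by simp
qed

lemma linear_Q8_act: "linear (Q8_act g)"
  by (rule linearI) (simp_all add: Q8_act_def qmult_def prod_eq_iff algebra_simps scaleR_conv_of_real)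

lemma Q8_act_mult: "Q8_act (g \<bullet>\<^sub>q h) x = Q8_act g (Q8_act h x)"
  by (simp add: Q8_act_def qmult_assoc)

lemma inner_Q8_act: "g \<in> carrier Q8 \<Longrightarrow> Q8_act g x \<bullet> Q8_act g y = x \<bullet> y"
  using linear_Q8_act[of g] norm_Q8_act[of g] norm_Q8[of g]
  by (metis mult_1 orthogonal_transformation orthogonal_transformation_def)

lemma continuous_on_Q8_act: "continuous_on S (Q8_act g)"
  using linear_Q8_act linear_continuous_on linear_conv_bounded_linear by blast

interpretation Q8: continuous_action Q8 "top_of_set S7" Q8_act
proof -
  interpret group Q8 by (rule group_Q8)
  show "continuous_action Q8 (top_of_set S7) Q8_act"
    by unfold_locales
      (auto simp: continuous_map_in_subtopology continuous_on_Q8_act Q8_act_S7 Q8_act_mult Q8_def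
        Q8_act_def[of q1])
qed

text \<open>Left multiplication by \<open>g - q1\<close> scales norms by
  \<open>norm (g - q1)\<close>, whose square is 4 for \<open>- q1\<close> and 2 for the other
  nontrivial elements. The bound 1 suffices and explains the radius 1/2 used for sheets.\<close>

lemma Q8_act_moves:
  assumes "g \<in> carrier Q8" "g \<noteq> q1" "norm x = 1"
  shows "norm (Q8_act g x - x) \<ge> 1"
proof -
  have "Q8_act g x - x = Q8_act (g - q1) x"
    by (simp add: Q8_act_def qmult_diff_left prod_eq_iff)
  then have "norm (Q8_act g x - x) = norm (g - q1)"
    using assms(3) by (simp add: norm_Q8_act)
  moreover have "(norm (g - q1))\<^sup>2 \<ge> 1"
    using assms(1,2)
    by (auto simp: Q8_def q1_def qi_def qj_def qk_def norm_prod_def cmod_power2)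
  ultimately show ?thesis using power2_le_imp_le[of 1 "norm (g - q1)"] by simp
qed

lemma orbit_eq_iff_S7:
  assumes "x \<in> S7" "y \<in> S7"
  shows "orbit Q8 Q8_act x = orbit Q8 Q8_act y \<longleftrightarrow> (\<exists>g\<in>carrier Q8. y = Q8_act g x)"
  using Q8.orbit_eq_iff[of x y] assms by simp

lemma inj_on_orbit_near:
  assumes "W \<subseteq> S7 \<inter> ball x (1/2)"
  shows "inj_on (orbit Q8 Q8_act) W"
proof (rule inj_onI)
  fix y z assume yz: "y \<in> W" "z \<in> W" "orbit Q8 Q8_act y = orbit Q8 Q8_act z"
  then obtain g where g: "g \<in> carrier Q8" "z = Q8_act g y"
    using orbit_eq_iff_S7 assms by blast
  have "y \<in> ball x (1/2)" "z \<in> ball x (1/2)" using yz assms by blast+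
  then have "dist z y < 1" using dist_triangle_half_r[of x z 1 y] by simp
  moreover have "norm y = 1" using yz assms by (auto simp: S7_def)
  ultimately have "g = q1" using g Q8_act_moves[of g y] by (auto simp: dist_norm)
  then show "y = z" using g by (simp add: Q8_act_def)
qed

lemma covering_quotient_S7: "covering_quotient (top_of_set S7) S7_mod_Q8 (orbit Q8 Q8_act)"
proof
  show "\<exists>W. openin (top_of_set S7) W \<and> x \<in> W \<and> inj_on (orbit Q8 Q8_act) W"
    if "x \<in> topspace (top_of_set S7)" for x
    using that inj_on_orbit_near[of "S7 \<inter> ball x (1/2)" x]
    by (intro exI[of _ "S7 \<inter> ball x (1/2)"]) auto
qed (simp_all only: S7_mod_Q8_def Q8.open_map_orbit quotient_imp_continuous_map[OF Q8.quotient_map_orbit]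
    quotient_imp_surjective_map[OF Q8.quotient_map_orbit])

interpretation S7: covering_quotient "top_of_set S7" S7_mod_Q8 "orbit Q8 Q8_act"
  by (rule covering_quotient_S7)

text \<open>Equal values lie over one orbit, so \<open>y\<close> is a translate of \<open>x\<close>;
  invariance moves both vectors to the fibre over \<open>y\<close>, where \<open>q_inj\<close>
  compares them. The resulting relation does not mention \<open>q\<close>, so any two such
  presentations have the same kernel.\<close>

lemma kernel_of_equivariant_presentation:
  assumes "presented_bundle (top_of_set S7) S7_mod_Q8 (orbit Q8 Q8_act) E q"
    and equiv: "\<And>g x u. g \<in> carrier Q8 \<Longrightarrow> x \<in> S7 \<Longrightarrow> q (Q8_act g x, Q8_act g u) = q (x, u)"
    and "x \<in> S7" "y \<in> S7"
  shows "q (x, u) = q (y, w) \<longleftrightarrow> (\<exists>g\<in>carrier Q8. y = Q8_act g x \<and> w = Q8_act g u)"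
proof
  interpret presented_bundle "top_of_set S7" S7_mod_Q8 "orbit Q8 Q8_act" E q by fact
  assume eq: "q (x, u) = q (y, w)"
  then have "orbit Q8 Q8_act x = orbit Q8 Q8_act y"
    using proj[of x u] proj[of y w] assms(3,4) by simp
  then obtain g where g: "g \<in> carrier Q8" "y = Q8_act g x"
    using orbit_eq_iff_S7 assms(3,4) by blast
  then have "q (y, Q8_act g u) = q (y, w)"
    using equiv assms(3) eq by simp
  then have "Q8_act g u = w" using q_inj[of y] assms(4) by simp
  then show "\<exists>g\<in>carrier Q8. y = Q8_act g x \<and> w = Q8_act g u"
    using g by blast
next
  assume "\<exists>g\<in>carrier Q8. y = Q8_act g x \<and> w = Q8_act g u"
  then obtain g where "g \<in> carrier Q8" "y = Q8_act g x" "w = Q8_act g u" by blast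
  then show "q (x, u) = q (y, w)" using equiv assms(3) by simp
qed

section \<open>The bundle \<open>\<eta>\<close>\<close>

text \<open>Identifies the fibre of the representation with the quaternions; under it
  \<open>rep_y g\<close> becomes left multiplication, so that \<open>eta\<close> is presented with
  the same action as on the sphere.\<close>

definition quat_vec :: "quat \<Rightarrow> complex^2" where
  "quat_vec h = vector [fst h, snd h]"

lemma rep_y_quat_vec: "rep_y g *v quat_vec h = quat_vec (g \<bullet>\<^sub>q h)"
  unfolding quat_vec_def by (rule rep_y_left_mult)

lemma homeomorphic_maps_quat_vec:
  "homeomorphic_maps euclidean euclidean quat_vec (\<lambda>v. (v $ 1, v $ 2))"
proof -
  have "continuous_on UNIV quat_vec"
  proof -
    have "linear quat_vec"
      by (rule linearI) (simp_all add: quat_vec_def vec_eq_iff forall_2)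
    then show ?thesis using linear_continuous_on linear_conv_bounded_linear by blast
  qed
  moreover have "continuous_on UNIV (\<lambda>v::complex^2. (v $ 1, v $ 2))"
    by (intro continuous_on_Pair continuous_on_component continuous_on_id)
  ultimately show ?thesis
    by (simp add: homeomorphic_maps_def quat_vec_def vec_eq_iff forall_2)
qed

lemma inj_quat_vec: "quat_vec h = quat_vec k \<longleftrightarrow> h = k"
  by (auto simp: quat_vec_def vec_eq_iff forall_2 prod_eq_iff)

definition eta_act :: "quat \<Rightarrow> (quat \<times> quat) \<times> (complex^2) \<Rightarrow> (quat \<times> quat) \<times> (complex^2)" where
  "eta_act g = (\<lambda>(x, v). (Q8_act g x, rep_y g *v v))"

interpretation eta: continuous_action Q8 "prod_topology (top_of_set S7) euclidean" eta_act
proof -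
  interpret group Q8 by (rule group_Q8)
  have "continuous_on UNIV ((*v) (rep_y g))" for g
  proof -
    have "linear ((*v) (rep_y g))"
      by (rule linearI)
        (simp_all add: rep_y_def vec_eq_iff forall_2 matrix_vector_mult_def sum_2 algebra_simps)
    then show ?thesis using linear_continuous_on linear_conv_bounded_linear by blast
  qed
  then have "continuous_map (prod_topology (top_of_set S7) euclidean) (prod_topology (top_of_set S7) euclidean)
      (eta_act g)" if "g \<in> carrier Q8" for g
    unfolding eta_act_def continuous_map_prod_top using Q8.act_continuous[OF that] by simp
  then show "continuous_action Q8 (prod_topology (top_of_set S7) euclidean) eta_act"
    by unfold_locales
      (auto simp: eta_act_def Q8_def Q8_act_mult rep_y_mult rep_y_one matrix_vector_mul_assoc
        Q8_act_def[of q1])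
qed

definition eta_map :: "(quat \<times> quat) \<times> quat \<Rightarrow> ((quat \<times> quat) \<times> (complex^2)) set" where
  "eta_map = (\<lambda>(x, h). orbit Q8 eta_act (x, quat_vec h))"

lemma eta_map_eq:
  "eta_map (x, h) = {(Q8_act g x, quat_vec (g \<bullet>\<^sub>q h)) | g. g \<in> carrier Q8}"
  by (auto simp: eta_map_def orbit_def eta_act_def rep_y_quat_vec)

lemma eta_map_equivariant:
  "g \<in> carrier Q8 \<Longrightarrow> x \<in> S7 \<Longrightarrow> eta_map (Q8_act g x, g \<bullet>\<^sub>q h) = eta_map (x, h)"
  using eta.orbit_act[of g "(x, quat_vec h)"]
  by (simp add: eta_map_def eta_act_def rep_y_quat_vec)

lemma Q8_act_cancel:
  assumes "g \<in> carrier Q8" "g' \<in> carrier Q8" "x \<in> S7" "Q8_act g x = Q8_act g' x"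
  shows "g = g'"
proof -
  have "Q8_act (g - g') x = 0"
    using assms(4) by (simp add: Q8_act_def qmult_diff_left prod_eq_iff)
  then have "norm (g - g') * norm x = 0"
    by (simp flip: norm_Q8_act)
  then show ?thesis using assms(3) by (auto simp: S7_def)
qed

lemma presented_bundle_eta:
  "presented_bundle (top_of_set S7) S7_mod_Q8 (orbit Q8 Q8_act) (underlying_real eta) eta_map"
proof -
  have total: "vb_total (underlying_real eta) =
      orbit_space Q8 eta_act (prod_topology (top_of_set S7) euclidean)"
    by (simp add: underlying_real_def eta_def assoc_bundle_def eta_act_def[abs_def])
  let ?j = "\<lambda>(x, h). (x, quat_vec h)"
  have j: "homeomorphic_map (prod_topology (top_of_set S7) euclidean)
      (prod_topology (top_of_set S7) euclidean) ?j"
  proof -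
    have "homeomorphic_maps (top_of_set S7) (top_of_set S7) (\<lambda>x. x) (\<lambda>x. x)"
      by (simp add: homeomorphic_maps_def)
    then have "homeomorphic_maps (prod_topology (top_of_set S7) euclidean)
      (prod_topology (top_of_set S7) euclidean) ?j (\<lambda>(x, v). (x, (v $ 1, v $ 2)))"
      using homeomorphic_maps_quat_vec by (simp add: homeomorphic_maps_prod)
    then show ?thesis by (rule homeomorphic_maps_imp_map)
  qed
  have map: "eta_map = orbit Q8 eta_act \<circ> ?j" by (auto simp: eta_map_def)
  have quot: "quotient_map (prod_topology (top_of_set S7) euclidean) (vb_total (underlying_real eta)) eta_map"
    unfolding total map
    using quotient_map_compose eta.quotient_map_orbit j homeomorphic_map_def by blast
  show ?thesis
  proof
    show "vb_base (underlying_real eta) = S7_mod_Q8"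
      by (simp add: underlying_real_def eta_def assoc_bundle_def S7_mod_Q8_def)
    show "continuous_map (prod_topology (top_of_set S7) euclidean) (vb_total (underlying_real eta)) eta_map"
      using quot by (rule quotient_imp_continuous_map)
    show "open_map (prod_topology (top_of_set S7) euclidean) (vb_total (underlying_real eta)) eta_map"
      unfolding total map using open_map_compose eta.open_map_orbit homeomorphic_imp_open_map[OF j] by blast
    show "eta_map ` (topspace (top_of_set S7) \<times> UNIV) = topspace (vb_total (underlying_real eta))"
      using quotient_imp_surjective_map[OF quot] by simp
    show "vb_proj (underlying_real eta) (eta_map (x, h)) = orbit Q8 Q8_act x" for x h
      by (force simp: underlying_real_def eta_def assoc_bundle_def eta_map_eq orbit_def)
    show "vb_add (underlying_real eta) (eta_map (x, h)) (eta_map (x, k)) = eta_map (x, h + k)"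
      if "x \<in> topspace (top_of_set S7)" for x h k
    proof -
      have x: "x \<in> S7" using that by simp
      have distrib: "quat_vec (g \<bullet>\<^sub>q (h + k)) = quat_vec (g \<bullet>\<^sub>q h) + quat_vec (g \<bullet>\<^sub>q k)" for g
        by (simp add: qmult_def quat_vec_def vec_eq_iff forall_2 algebra_simps)
      have "vb_add (underlying_real eta) (eta_map (x, h)) (eta_map (x, k)) =
        {(y, v + w) | y v w. (y, v) \<in> eta_map (x, h) \<and> (y, w) \<in> eta_map (x, k)}"
        by (simp add: underlying_real_def eta_def assoc_bundle_def)
      also have "\<dots> = {(Q8_act g x, quat_vec (g \<bullet>\<^sub>q h) + quat_vec (g' \<bullet>\<^sub>q k)) | g g'.
          g \<in> carrier Q8 \<and> g' \<in> carrier Q8 \<and> Q8_act g x = Q8_act g' x}"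
        unfolding eta_map_eq by blast
      \<comment> \<open>Freeness forces \<open>g = g'\<close>, so no sums of vectors from different
        translates occur.\<close>
      also have "\<dots> = eta_map (x, h + k)"
        unfolding eta_map_eq distrib using Q8_act_cancel[OF _ _ x] by blast
      finally show ?thesis .
    qed
    show "vb_scale (underlying_real eta) r (eta_map (x, h)) = eta_map (x, r *\<^sub>R h)" for r x h
    proof -
      have "quat_vec (g \<bullet>\<^sub>q (r *\<^sub>R h)) = complex_of_real r *s quat_vec (g \<bullet>\<^sub>q h)" for g
        by (simp add: qmult_def quat_vec_def vec_eq_iff forall_2 algebra_simps scaleR_conv_of_real)
      then have "eta_map (x, r *\<^sub>R h) = {(y, complex_of_real r *s v) | y v. (y, v) \<in> eta_map (x, h)}"
        unfolding eta_map_eq by (simp only: prod.inject) blast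
      then show ?thesis
        by (simp add: underlying_real_def eta_def assoc_bundle_def)
    qed
    show "h = k" if "x \<in> topspace (top_of_set S7)" "eta_map (x, h) = eta_map (x, k)" for x h k
    proof -
      have x: "x \<in> S7" using that(1) by simp
      note eq = that(2)
      \<comment> \<open>The representatives over \<open>x\<close> itself are compared; by freeness
        each class has exactly one.\<close>
      have "q1 \<in> carrier Q8" by (simp add: Q8_def)
      then have "(Q8_act q1 x, quat_vec (q1 \<bullet>\<^sub>q h)) \<in> eta_map (x, h)"
        unfolding eta_map_eq by blast
      then have "(Q8_act q1 x, quat_vec h) \<in> eta_map (x, k)" by (simp only: eq q1_qmult)
      then have "\<exists>g. (Q8_act q1 x, quat_vec h) = (Q8_act g x, quat_vec (g \<bullet>\<^sub>q k)) \<and> g \<in> carrier Q8"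
        unfolding eta_map_eq by (rule CollectD)
      then obtain g where g: "g \<in> carrier Q8" "Q8_act q1 x = Q8_act g x" "quat_vec h = quat_vec (g \<bullet>\<^sub>q k)"
        by (elim exE conjE Pair_inject)
      then have "g = q1" using Q8_act_free[OF x, of g] by (simp add: Q8_act_def[of q1])
      then show ?thesis using g(3) by (simp add: inj_quat_vec)
    qed
    show "\<exists>k. eta_map (y, h) = eta_map (x, k)"
      if xy: "x \<in> topspace (top_of_set S7)" "y \<in> topspace (top_of_set S7)"
        "orbit Q8 Q8_act x = orbit Q8 Q8_act y" for x y h
    proof -
      obtain g where g: "g \<in> carrier Q8" "x = Q8_act g y"
        using xy orbit_eq_iff_S7[of y x] by auto
      then have "eta_map (y, h) = eta_map (x, g \<bullet>\<^sub>q h)"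
        using eta_map_equivariant[of g y h] xy(2) by simp
      then show ?thesis by (rule exI)
    qed
  qed
qed

section \<open>Charts of \<open>S\<^sup>7/Q\<^sub>8\<close>\<close>

lemma orbit_Q8_act:
  "g \<in> carrier Q8 \<Longrightarrow> x \<in> S7 \<Longrightarrow> orbit Q8 Q8_act (Q8_act g x) = orbit Q8 Q8_act x"
  using Q8.orbit_act[of g x] by simp

text \<open>Orthogonal projection of a small neighbourhood of \<open>x\<close> in \<open>S\<^sup>7\<close> descends to a chart
  \<open>\<phi>\<close> of the quotient; on any other sheet \<open>\<phi> \<circ> \<pi>\<close> differs from it by the action of a group
  element.\<close>

lemma S7_mod_Q8_atlas_covers:
  assumes "x \<in> S7"
  shows "\<exists>c\<in>S7_mod_Q8_atlas. orbit Q8 Q8_act x \<in> fst c"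
proof -
  let ?\<pi> = "orbit Q8 Q8_act"
  have norm_x: "norm x = 1" using assms by (simp add: S7_def)
  have "DIM(quat \<times> quat) = Suc DIM(real^7)" by simp
  then obtain T :: "quat \<times> quat \<Rightarrow> real^7" and D \<kappa> where linT: "linear T" and openD: "open D"
    and smooth\<kappa>: "\<And>k. C_k_on k \<kappa> D"
    and T\<kappa>: "\<And>z. norm z = 1 \<Longrightarrow> x \<bullet> z > 0 \<Longrightarrow> T z \<in> D \<and> \<kappa> (T z) = z"
    and \<kappa>T: "\<And>y. y \<in> D \<Longrightarrow> norm (\<kappa> y) = 1 \<and> T (\<kappa> y) = y"
    using sphere_projection_chart[OF norm_x] by metis
  \<comment> \<open>The radius does two jobs: the orbit map is injective on \<open>W\<close>, and
    \<open>W\<close> lies in the open hemisphere around \<open>x\<close>, since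
    \<open>2 - 2 * (x \<bullet> z) < 1/4\<close>.\<close>
  define W where "W = S7 \<inter> ball x (1/2)"
  have W: "openin (top_of_set S7) W" "x \<in> W" "W \<subseteq> S7" using assms by (auto simp: W_def)
  have injW: "inj_on ?\<pi> W" by (rule inj_on_orbit_near[of _ x]) (simp add: W_def)
  have TW: "T z \<in> D" "\<kappa> (T z) = z" if "z \<in> W" for z
  proof -
    have z: "norm z = 1" "norm (x - z) < 1/2" using that by (auto simp: W_def S7_def dist_norm)
    have "(norm (x - z))\<^sup>2 < (1/2)\<^sup>2" using z(2) by (intro power_strict_mono) auto
    moreover have "(norm (x - z))\<^sup>2 = 2 - 2 * (x \<bullet> z)"
      using norm_x z(1) by (simp add: power2_norm_eq_inner inner_diff inner_commute norm_eq_1)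
    ultimately have "x \<bullet> z > 0" by (simp add: power2_eq_square)
    then show "T z \<in> D" "\<kappa> (T z) = z" using T\<kappa> z(1) by auto
  qed
  have cont\<kappa>: "continuous_on D \<kappa>" using smooth\<kappa>[of 0] by simp
  have contT: "continuous_on A T" for A
    using linT linear_continuous_on linear_conv_bounded_linear by blast
  \<comment> \<open>Openness of the coordinate image is obtained by describing it as a preimage
    under the continuous inverse \<open>\<kappa>\<close>.\<close>
  have TW_eq: "T ` W = D \<inter> \<kappa> -` ball x (1/2)"
  proof
    show "T ` W \<subseteq> D \<inter> \<kappa> -` ball x (1/2)" using TW by (auto simp: W_def)
    show "D \<inter> \<kappa> -` ball x (1/2) \<subseteq> T ` W"
    proof
      fix y assume y: "y \<in> D \<inter> \<kappa> -` ball x (1/2)"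
      then have "\<kappa> y \<in> W" using \<kappa>T by (simp add: W_def S7_def)
      moreover have "y = T (\<kappa> y)" using y \<kappa>T by simp
      ultimately show "y \<in> T ` W" by blast
    qed
  qed
  have \<kappa>W: "\<kappa> y \<in> W" "T (\<kappa> y) = y" "y \<in> D" if "y \<in> T ` W" for y
    using that TW by auto
  have openTW: "open (T ` W)"
    unfolding TW_eq by (rule continuous_open_preimage[OF cont\<kappa> openD open_ball])
  define \<phi> where "\<phi> = T \<circ> inv_into W ?\<pi>"
  have \<phi>: "\<phi> (?\<pi> z) = T z" if "z \<in> W" for z
    using that injW by (simp add: \<phi>_def)
  \<comment> \<open>On a translate of \<open>W\<close> the lifted chart is thus the restriction of a
    linear map.\<close>
  have \<phi>_act: "\<phi> (?\<pi> z) = T (Q8_act g z)" if "g \<in> carrier Q8" "z \<in> S7" "Q8_act g z \<in> W" for g z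
    using \<phi>[OF that(3)] orbit_Q8_act[OF that(1,2)] by simp
  have inj\<phi>: "inj_on \<phi> (?\<pi> ` W)"
  proof (rule inj_onI)
    fix p q assume "p \<in> ?\<pi> ` W" "q \<in> ?\<pi> ` W" and eq: "\<phi> p = \<phi> q"
    then obtain y z where yz: "y \<in> W" "p = ?\<pi> y" "z \<in> W" "q = ?\<pi> z" by blast
    have "T y = T z" using eq unfolding yz(2,4) \<phi>[OF yz(1)] \<phi>[OF yz(3)] .
    then have "y = z" using arg_cong[of _ _ \<kappa>] TW(2)[OF yz(1)] TW(2)[OF yz(3)] by metis
    then show "p = q" by (simp only: yz(2,4))
  qed
  have image\<phi>: "\<phi> ` ?\<pi> ` W = T ` W" using \<phi> by (auto simp: image_image)
  have "homeomorphic_maps (subtopology S7_mod_Q8 (?\<pi> ` W)) (top_of_set (T ` W)) \<phi> (?\<pi> \<circ> \<kappa>)"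
    unfolding homeomorphic_maps_def
  proof (intro conjI ballI)
    have "continuous_map (subtopology (top_of_set S7) W) euclidean T"
      using contT by (simp add: subtopology_subtopology)
    from continuous_map_compose[OF S7.continuous_map_inv_into[OF W(1) injW] this]
    show "continuous_map (subtopology S7_mod_Q8 (?\<pi> ` W)) (top_of_set (T ` W)) \<phi>"
      using \<phi> by (auto simp: continuous_map_in_subtopology \<phi>_def[symmetric])
    have "continuous_map (top_of_set (T ` W)) (top_of_set S7) \<kappa>"
      using \<kappa>W W(3) by (auto simp: continuous_map_in_subtopology intro!: continuous_on_subset[OF cont\<kappa>])
    from continuous_map_compose[OF this S7.cont]
    show "continuous_map (top_of_set (T ` W)) (subtopology S7_mod_Q8 (?\<pi> ` W)) (?\<pi> \<circ> \<kappa>)"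
      using \<kappa>W by (auto simp: continuous_map_in_subtopology)
    show "(?\<pi> \<circ> \<kappa>) (\<phi> p) = p" if "p \<in> topspace (subtopology S7_mod_Q8 (?\<pi> ` W))" for p
      using that \<phi> TW(2) by auto
    show "\<phi> ((?\<pi> \<circ> \<kappa>) y) = y" if "y \<in> topspace (top_of_set (T ` W))" for y
      using that \<phi> \<kappa>W by simp
  qed
  then have "homeomorphic_map (subtopology S7_mod_Q8 (?\<pi> ` W)) (top_of_set (T ` W)) \<phi>"
    by (rule homeomorphic_maps_imp_map)
  then have top: "topological_chart S7_mod_Q8 (?\<pi> ` W, \<phi>)"
    using S7.openin_image[OF W(1)] openTW by (simp add: topological_chart_def image\<phi>)
  \<comment> \<open>\<open>quotient_atlas\<close> tests every \<open>V\<close> on which the orbit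
    map is injective. Such a \<open>V\<close> may meet several translates of \<open>W\<close>, so
    the group element is chosen separately near each point.\<close>
  have "(V, \<phi> \<circ> ?\<pi>) \<in> submanifold_atlas S7"
    if V: "openin (top_of_set S7) V" "inj_on ?\<pi> V" "?\<pi> ` V \<subseteq> ?\<pi> ` W" for V
  proof -
    let ?f = "\<phi> \<circ> ?\<pi>"
    have VS: "V \<subseteq> S7" using openin_imp_subset[OF V(1)] .
    obtain O' where O': "open O'" "V = S7 \<inter> O'" using V(1) openin_open by blast
    have inj: "inj_on ?f V"
      using V(2,3) inj\<phi> by (intro comp_inj_on) (auto intro: inj_on_subset)
    have smooth: "smooth_on V ?f"
      unfolding smooth_on_def
    proof
      fix z assume z: "z \<in> V"
      then obtain w where w: "w \<in> W" "?\<pi> z = ?\<pi> w" using V(3) by blast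
      then obtain g where g: "g \<in> carrier Q8" "w = Q8_act g z"
        using orbit_eq_iff_S7[of z w] z VS W(3) by blast
      have "open (Q8_act g -` ball x (1/2))"
        by (rule open_vimage[OF open_ball continuous_on_Q8_act])
      moreover have "z \<in> Q8_act g -` ball x (1/2)" using w(1) g(2) by (simp add: W_def)
      moreover have "C_k_on k (T \<circ> Q8_act g) (Q8_act g -` ball x (1/2))" for k
        using linear_compose[OF linear_Q8_act linT]
        by (intro C_k_on_bounded_linear) (simp add: linear_conv_bounded_linear)
      moreover have "(T \<circ> Q8_act g) y = ?f y" if "y \<in> V \<inter> Q8_act g -` ball x (1/2)" for y
      proof -
        have "y \<in> S7" using that VS by blast
        moreover from this have "Q8_act g y \<in> W" using that Q8_act_S7[OF g(1)] by (simp add: W_def)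
        ultimately show ?thesis using \<phi>_act[OF g(1)] by simp
      qed
      ultimately show "\<exists>N F. open N \<and> z \<in> N \<and> (\<forall>k. C_k_on k F N) \<and> (\<forall>y\<in>V \<inter> N. F y = ?f y)"
        by blast
    qed
    \<comment> \<open>Yields both the openness of the image of \<open>V\<close> and the smoothness
      of the inverse chart.\<close>
    have local_inverse: "\<exists>N F. open N \<and> y \<in> N \<and> N \<subseteq> ?f ` V \<and> (\<forall>k. C_k_on k F N) \<and>
        (\<forall>y'\<in>N. F y' = inv_into V ?f y')" if y: "y \<in> ?f ` V" for y
    proof -
      obtain z where z: "z \<in> V" "y = ?f z" using y by blast
      obtain w where w: "w \<in> W" "?\<pi> w = ?\<pi> z" using V(3) z(1) by blast
      then obtain h where h: "h \<in> carrier Q8" "z = Q8_act h w"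
        using orbit_eq_iff_S7[of w z] z(1) VS W(3) by blast
      let ?F = "\<lambda>y. Q8_act h (\<kappa> y)"
      \<comment> \<open>Among the lifts of a point of the quotient, the one by \<open>h\<close> must
        remain in \<open>V\<close>; since \<open>V = S7 \<inter> O'\<close>, the preimage of
        \<open>O'\<close> ensures this.\<close>
      let ?N = "T ` W \<inter> ?F -` O'"
      have smoothF: "C_k_on k ?F (T ` W)" for k
      proof (rule C_k_on_bounded_linear_compose[of "Q8_act h", OF _ openTW])
        show "bounded_linear (Q8_act h)" using linear_Q8_act by (simp only: linear_conv_bounded_linear)
        show "C_k_on k \<kappa> (T ` W)" using smooth\<kappa> \<kappa>W(3) by (rule C_k_on_subset[OF _ subsetI])
      qed
      have "open ?N"
        using smoothF[of 0] by (intro continuous_open_preimage[OF _ openTW O'(1)]) simp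
      moreover have "y \<in> ?N"
      proof -
        have y: "y = T w" unfolding z(2) o_apply w(2)[symmetric] by (rule \<phi>[OF w(1)])
        have "?F y = z" unfolding y TW(2)[OF w(1)] by (rule h(2)[symmetric])
        then show ?thesis using y w(1) z(1) O'(2) by blast
      qed
      moreover have *: "?F y' \<in> V" "?f (?F y') = y'" if "y' \<in> ?N" for y'
      proof -
        have \<kappa>y': "\<kappa> y' \<in> W" "T (\<kappa> y') = y'" using that \<kappa>W by auto
        then have "\<kappa> y' \<in> S7" using W(3) by blast
        then show "?F y' \<in> V" "?f (?F y') = y'"
          using that Q8_act_S7[OF h(1)] O'(2) orbit_Q8_act[OF h(1)] \<phi>[OF \<kappa>y'(1)] \<kappa>y'(2)
          by (blast, simp)
      qed
      moreover have "?N \<subseteq> ?f ` V"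
      proof
        show "y' \<in> ?f ` V" if "y' \<in> ?N" for y'
          using *(2)[OF that, symmetric] *(1)[OF that] by (rule image_eqI)
      qed
      moreover have "?F y' = inv_into V ?f y'" if "y' \<in> ?N" for y'
        using inv_into_f_eq[OF inj *(1)[OF that] *(2)[OF that]] by (rule sym)
      moreover have "C_k_on k ?F ?N" for k using smoothF by (rule C_k_on_subset) simp
      ultimately show ?thesis by (intro exI[of _ ?N] exI[of _ ?F] conjI allI ballI)
    qed
    have "open (?f ` V)"
      by (subst open_subopen) (use local_inverse in blast)
    moreover have "smooth_on (?f ` V) (inv_into V ?f)"
      unfolding smooth_on_def
    proof
      fix y assume "y \<in> ?f ` V"
      from local_inverse[OF this] obtain N F where "open N" "y \<in> N" "\<forall>k. C_k_on k F N"
        "\<forall>y'\<in>N. F y' = inv_into V ?f y'" by blast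
      then show "\<exists>N F. open N \<and> y \<in> N \<and> (\<forall>k. C_k_on k F N) \<and>
          (\<forall>y'\<in>?f ` V \<inter> N. F y' = inv_into V ?f y')"
        by (metis IntD2)
    qed
    ultimately show ?thesis by (intro submanifold_atlasI V(1) inj smooth)
  qed
  then have "(?\<pi> ` W, \<phi>) \<in> S7_mod_Q8_atlas"
    using top by (auto simp: S7_mod_Q8_atlas_def quotient_atlas_def S7_mod_Q8_def orbit_space_def)
  then show ?thesis using W(2) by (intro bexI[of _ "(?\<pi> ` W, \<phi>)"]) auto
qed

section \<open>The tangent bundle\<close>

lemma continuous_map_locally:
  assumes "\<And>x. x \<in> topspace X \<Longrightarrow> \<exists>N. openin X N \<and> x \<in> N \<and> continuous_map (subtopology X N) Y f"
  shows "continuous_map X Y f"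
  by (rule pasting_lemma[where I = "{N. openin X N \<and> continuous_map (subtopology X N) Y f}"
        and T = "\<lambda>N. N" and f = "\<lambda>N. f"]) (use assms in auto)

lemma S7_norm: "x \<in> S7 \<Longrightarrow> norm x = 1"
  by (simp add: S7_def)

lemma S7_inner_self: "x \<in> S7 \<Longrightarrow> x \<bullet> x = 1"
  by (simp add: S7_norm flip: power2_norm_eq_inner)

text \<open>Derivatives of a chart \<open>\<phi>\<close> of the quotient are computed on the ambient space by extending
  \<open>\<phi> \<circ> \<pi>\<close> radially: \<open>chart_deriv c x\<close> is the composite of the projection onto
  \<open>T\<^sub>x S\<^sup>7 = x\<^sup>\<bottom>\<close> with the derivative of \<open>\<phi> \<circ> \<pi>\<close>, and \<open>chart_lift c x\<close> inverts it on \<open>x\<^sup>\<bottom>\<close>.\<close>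

definition chart_deriv :: "((quat \<times> quat) set, real^7) chart \<Rightarrow> quat \<times> quat \<Rightarrow> quat \<times> quat \<Rightarrow> real^7" where
  "chart_deriv c = radial_deriv (snd c \<circ> orbit Q8 Q8_act)"

definition chart_lift :: "((quat \<times> quat) set, real^7) chart \<Rightarrow> quat \<times> quat \<Rightarrow> real^7 \<Rightarrow> quat \<times> quat" where
  "chart_lift c x v = (THE u. x \<bullet> u = 0 \<and> chart_deriv c x u = v)"

definition chart_domain :: "((quat \<times> quat) set, real^7) chart \<Rightarrow> (quat \<times> quat) set" where
  "chart_domain c = {x \<in> S7. orbit Q8 Q8_act x \<in> fst c}"

section \<open>Derivatives of quotient charts on the sphere\<close>

lemma chart_at:
  assumes "x \<in> S7"
  obtains c where "c \<in> S7_mod_Q8_atlas" "x \<in> chart_domain c"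
  using S7_mod_Q8_atlas_covers[OF assms] assms unfolding chart_domain_def by blast

lemma chart_inj: "c \<in> S7_mod_Q8_atlas \<Longrightarrow> inj_on (snd c) (fst c)"
  and chart_open: "c \<in> S7_mod_Q8_atlas \<Longrightarrow> openin S7_mod_Q8 (fst c)"
proof -
  assume "c \<in> S7_mod_Q8_atlas"
  then have *: "openin S7_mod_Q8 (fst c)"
      "homeomorphic_map (subtopology S7_mod_Q8 (fst c)) (top_of_set (snd c ` fst c)) (snd c)"
    by (auto simp: S7_mod_Q8_atlas_def quotient_atlas_def topological_chart_def S7_mod_Q8_def orbit_space_def)
  then show "openin S7_mod_Q8 (fst c)" by simp
  have "topspace S7_mod_Q8 \<inter> fst c = fst c" using openin_subset[OF *(1)] by blast
  then show "inj_on (snd c) (fst c)"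
    using homeomorphic_imp_injective_map[OF *(2)] by simp
qed

lemma openin_chart_domain: "c \<in> S7_mod_Q8_atlas \<Longrightarrow> openin (top_of_set S7) (chart_domain c)"
  using openin_continuous_map_preimage[OF S7.cont chart_open] by (simp add: chart_domain_def)

text \<open>A nonempty \<open>chart_domain\<close> is a union of whole orbits, while
  \<open>quotient_atlas\<close> speaks only of sets on which the orbit map is injective; the ball
  cuts out such a set.\<close>

definition sheet :: "((quat \<times> quat) set, real^7) chart \<Rightarrow> quat \<times> quat \<Rightarrow> (quat \<times> quat) set" where
  "sheet c x = chart_domain c \<inter> ball x (1/2)"

lemma openin_sheet: "c \<in> S7_mod_Q8_atlas \<Longrightarrow> openin (top_of_set S7) (sheet c x)"
  unfolding sheet_def by (intro openin_Int_open openin_chart_domain) simp_all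

lemma sheet_chart:
  assumes "c \<in> S7_mod_Q8_atlas"
  shows "sphere_chart (sheet c x) (snd c \<circ> orbit Q8 Q8_act)"
proof
  have "inj_on (orbit Q8 Q8_act) (sheet c x)"
    by (rule inj_on_orbit_near[of _ x]) (auto simp: sheet_def chart_domain_def)
  moreover have "orbit Q8 Q8_act ` sheet c x \<subseteq> fst c"
    by (auto simp: sheet_def chart_domain_def)
  ultimately show "(sheet c x, snd c \<circ> orbit Q8 Q8_act) \<in> submanifold_atlas (sphere 0 1)"
    using assms openin_sheet[OF assms, of x]
    by (auto simp: S7_mod_Q8_atlas_def quotient_atlas_def S7_def)
qed

lemma mem_sheet: "x \<in> chart_domain c \<Longrightarrow> x \<in> sheet c x"
  by (simp add: sheet_def)

text \<open>The two inverse laws of the chart on the sheet show that \<open>D\<theta>\<close> gives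
  the unique vector in the description. Hence the lift does not depend on the centre
  \<open>x\<close>, and results on sheets glue over the whole chart domain.\<close>

lemma chart_lift_eq:
  assumes "c \<in> S7_mod_Q8_atlas" "y \<in> sheet c x"
  shows "chart_lift c y v = sphere_chart.D\<theta> (sheet c x) (snd c \<circ> orbit Q8 Q8_act) y v"
proof -
  interpret sphere_chart "sheet c x" "snd c \<circ> orbit Q8 Q8_act" by (rule sheet_chart[OF assms(1)])
  show ?thesis
    unfolding chart_lift_def chart_deriv_def
  proof (rule the_equality)
    show "y \<bullet> D\<theta> y v = 0 \<and> radial_deriv (snd c \<circ> orbit Q8 Q8_act) y (D\<theta> y v) = v"
      using D\<theta>_orthogonal[OF assms(2)] radial_D\<theta>[OF assms(2)] by simp
    show "u = D\<theta> y v" if "y \<bullet> u = 0 \<and> radial_deriv (snd c \<circ> orbit Q8 Q8_act) y u = v" for u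
      using D\<theta>_radial[OF assms(2), of u] that by simp
  qed
qed

lemma
  assumes "c \<in> S7_mod_Q8_atlas" "x \<in> chart_domain c"
  shows linear_chart_deriv: "linear (chart_deriv c x)"
    and chart_deriv_self: "chart_deriv c x x = 0"
    and chart_deriv_lift: "chart_deriv c x (chart_lift c x v) = v"
    and chart_lift_deriv: "chart_lift c x (chart_deriv c x u) = u - (x \<bullet> u) *\<^sub>R x"
    and chart_lift_orthogonal: "x \<bullet> chart_lift c x v = 0"
    and chart_has_derivative:
      "((snd c \<circ> orbit Q8 Q8_act) \<circ> sgn has_derivative chart_deriv c x) (at x)"
proof -
  interpret sphere_chart "sheet c x" "snd c \<circ> orbit Q8 Q8_act" by (rule sheet_chart[OF assms(1)])
  note x = mem_sheet[OF assms(2)]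
  note lift = chart_lift_eq[OF assms(1) x]
  show "linear (chart_deriv c x)" "chart_deriv c x x = 0" "chart_deriv c x (chart_lift c x v) = v"
    "chart_lift c x (chart_deriv c x u) = u - (x \<bullet> u) *\<^sub>R x" "x \<bullet> chart_lift c x v = 0"
    "((snd c \<circ> orbit Q8 Q8_act) \<circ> sgn has_derivative chart_deriv c x) (at x)"
    unfolding lift chart_deriv_def
    by (fact linear_radial[OF x] radial_self[OF x] radial_D\<theta>[OF x] D\<theta>_radial[OF x]
        D\<theta>_orthogonal[OF x] radial_has_derivative[OF x])+
qed

lemma chart_deriv_add_radial:
  assumes "c \<in> S7_mod_Q8_atlas" "x \<in> chart_domain c"
  shows "chart_deriv c x (u + r *\<^sub>R x) = chart_deriv c x u"
  using linear_add[OF linear_chart_deriv[OF assms]] linear_cmul[OF linear_chart_deriv[OF assms]]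
    chart_deriv_self[OF assms] by simp

lemma continuous_on_sheets:
  fixes f :: "quat \<times> quat \<Rightarrow> 'b::topological_space \<Rightarrow> 'c::topological_space"
  assumes "c \<in> S7_mod_Q8_atlas" "\<And>x. continuous_on (sheet c x \<times> UNIV) (\<lambda>(y, v). f y v)"
  shows "continuous_on (chart_domain c \<times> UNIV) (\<lambda>(y, v). f y v)"
proof (rule continuous_on_locally)
  fix z :: "(quat \<times> quat) \<times> 'b" assume z: "z \<in> chart_domain c \<times> UNIV"
  let ?N = "ball (fst z) (1/2) \<times> (UNIV :: 'b set)"
  have "chart_domain c \<times> UNIV \<inter> ?N = sheet c (fst z) \<times> UNIV"
    by (auto simp: sheet_def)
  then have "continuous_on (chart_domain c \<times> UNIV \<inter> ?N) (\<lambda>(y, v). f y v)"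
    using assms(2) by simp
  moreover have "open ?N" "z \<in> ?N" by (simp_all add: open_Times mem_Times_iff)
  ultimately show "\<exists>N. open N \<and> z \<in> N \<and> continuous_on (chart_domain c \<times> UNIV \<inter> N) (\<lambda>(y, v). f y v)"
    by blast
qed

lemma continuous_on_chart_deriv:
  assumes "c \<in> S7_mod_Q8_atlas"
  shows "continuous_on (chart_domain c \<times> UNIV) (\<lambda>(x, u). chart_deriv c x u)"
  unfolding chart_deriv_def
  by (rule continuous_on_sheets[OF assms sphere_chart.continuous_on_radial[OF sheet_chart[OF assms]]])

lemma continuous_on_chart_lift:
  assumes "c \<in> S7_mod_Q8_atlas"
  shows "continuous_on (chart_domain c \<times> UNIV) (\<lambda>(x, v). chart_lift c x v)"
proof (rule continuous_on_sheets[OF assms])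
  fix x
  show "continuous_on (sheet c x \<times> UNIV) (\<lambda>(y, v). chart_lift c y v)"
    using sphere_chart.continuous_on_D\<theta>[OF sheet_chart[OF assms, of x]]
    by - (erule continuous_on_eq, auto simp: chart_lift_eq[OF assms])
qed

lemma chart_domain_act:
  "g \<in> carrier Q8 \<Longrightarrow> x \<in> chart_domain c \<Longrightarrow> Q8_act g x \<in> chart_domain c"
  using Q8.orbit_act[of g x] by (simp add: chart_domain_def Q8_act_S7)

text \<open>Being a linear isometry, \<open>Q8_act g\<close> commutes with \<open>sgn\<close>, and
  the orbit map absorbs it. So the radially extended chart is invariant away from \<open>0\<close>,
  and differentiating gives the claim.\<close>

lemma chart_deriv_equivariant:
  assumes "c \<in> S7_mod_Q8_atlas" "x \<in> chart_domain c" "g \<in> carrier Q8"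
  shows "chart_deriv c (Q8_act g x) (Q8_act g u) = chart_deriv c x u"
proof -
  let ?f = "(snd c \<circ> orbit Q8 Q8_act) \<circ> sgn"
  have x: "x \<in> S7" using assms(2) by (simp add: chart_domain_def)
  have "(?f \<circ> Q8_act g has_derivative chart_deriv c (Q8_act g x) \<circ> Q8_act g) (at x)"
    using linear_imp_has_derivative[OF linear_Q8_act]
      chart_has_derivative[OF assms(1) chart_domain_act[OF assms(3,2)]]
    by (rule diff_chain_at)
  then have "(?f has_derivative chart_deriv c (Q8_act g x) \<circ> Q8_act g) (at x)"
  proof (rule has_derivative_transform_within_open)
    show "open (- {0 :: quat \<times> quat})" by (rule open_Compl[OF closed_singleton])
    show "x \<in> - {0}" using S7_norm[OF x] by auto
    fix z :: "quat \<times> quat" assume "z \<in> - {0}"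
    then have z: "sgn z \<in> S7" by (simp add: S7_def norm_sgn)
    have "sgn (Q8_act g z) = Q8_act g (sgn z)"
      using norm_Q8[OF assms(3)] linear_cmul[OF linear_Q8_act]
      by (simp add: sgn_div_norm norm_Q8_act)
    then show "(?f \<circ> Q8_act g) z = ?f z"
      using Q8.orbit_act[of g "sgn z"] assms(3) z by simp
  qed
  then have "chart_deriv c (Q8_act g x) \<circ> Q8_act g = chart_deriv c x"
    using chart_has_derivative[OF assms(1,2)] has_derivative_unique by blast
  then show ?thesis by (metis comp_apply)
qed

text \<open>Links \<open>tangent_rel\<close> to ambient calculus: lift a coordinate vector to the
  tangent space of the sphere by one chart and push it down by the other. This is
  \<open>deriv_in_chart\<close> applied to the transition map.\<close>

lemma transition_deriv:
  assumes "c \<in> S7_mod_Q8_atlas" "c' \<in> S7_mod_Q8_atlas" "x \<in> chart_domain c" "x \<in> chart_domain c'"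
  shows "frechet_derivative (snd c' \<circ> inv_into (fst c) (snd c)) (at (snd c (orbit Q8 Q8_act x))) v =
    chart_deriv c' x (chart_lift c x v)"
proof -
  let ?f = "snd c' \<circ> inv_into (fst c) (snd c)"
  interpret sphere_chart "sheet c x" "snd c \<circ> orbit Q8 Q8_act" by (rule sheet_chart[OF assms(1)])
  note x = mem_sheet[OF assms(3)]
  have "(?f has_derivative chart_deriv c' x \<circ> D\<theta> x) (at ((snd c \<circ> orbit Q8 Q8_act) x))"
    unfolding chart_deriv_def
  proof (rule deriv_in_chart[OF x])
    show "((snd c' \<circ> orbit Q8 Q8_act) \<circ> sgn has_derivative
        radial_deriv (snd c' \<circ> orbit Q8 Q8_act) x) (at x)"
      using chart_has_derivative[OF assms(2,4)] by (simp add: chart_deriv_def)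
    fix y assume "y \<in> (snd c \<circ> orbit Q8 Q8_act) ` sheet c x"
    then obtain z where z: "z \<in> sheet c x" "y = (snd c \<circ> orbit Q8 Q8_act) z" by blast
    then have "orbit Q8 Q8_act z \<in> fst c" by (simp add: sheet_def chart_domain_def)
    then show "(snd c' \<circ> orbit Q8 Q8_act) (\<theta> y) = ?f y"
      using z theta_psi[OF z(1)] inv_into_f_f[OF chart_inj[OF assms(1)]] by simp
  qed
  from frechet_derivative_at[OF this] show ?thesis
    using chart_lift_eq[OF assms(1) x] by (simp add: fun_eq_iff)
qed

text \<open>The image of \<open>u\<close> under the derivative of the orbit map, listed as its
  coordinate vectors in all charts at the point, so that it is literally a class of
  \<open>tangent_rel\<close>.\<close>

definition tangent_class ::
  "(quat \<times> quat) \<times> (quat \<times> quat) \<Rightarrow>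
    (((quat \<times> quat) set, real^7) chart \<times> (quat \<times> quat) set \<times> (real^7)) set" where
  "tangent_class = (\<lambda>(x, u).
     (\<lambda>c. (c, orbit Q8 Q8_act x, chart_deriv c x u)) ` {c \<in> S7_mod_Q8_atlas. x \<in> chart_domain c})"

abbreviation (input) TB where "TB \<equiv> tangent_bundle S7_mod_Q8 S7_mod_Q8_atlas"

lemma tangent_rel_image:
  assumes "c \<in> S7_mod_Q8_atlas" "x \<in> chart_domain c"
  shows "tangent_rel S7_mod_Q8_atlas `` {(c, orbit Q8 Q8_act x, v)} = tangent_class (x, chart_lift c x v)"
proof -
  have x: "x \<in> S7" "orbit Q8 Q8_act x \<in> fst c" using assms(2) by (auto simp: chart_domain_def)
  have "tangent_rel S7_mod_Q8_atlas `` {(c, orbit Q8 Q8_act x, v)} =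
    {(c', orbit Q8 Q8_act x,
      frechet_derivative (snd c' \<circ> inv_into (fst c) (snd c)) (at (snd c (orbit Q8 Q8_act x))) v) | c'.
      c' \<in> S7_mod_Q8_atlas \<and> x \<in> chart_domain c'}"
    using assms(1) x by (cases c) (auto simp: tangent_rel_def chart_domain_def)
  also have "\<dots> = tangent_class (x, chart_lift c x v)"
    unfolding tangent_class_def prod.case setcompr_eq_image
    by (rule image_cong) (simp_all add: transition_deriv[OF assms(1) _ assms(2)])
  finally show ?thesis .
qed

lemma tangent_class_equivariant:
  assumes "g \<in> carrier Q8" "x \<in> S7"
  shows "tangent_class (Q8_act g x, Q8_act g u) = tangent_class (x, u)"
proof -
  have orb: "orbit Q8 Q8_act (Q8_act g x) = orbit Q8 Q8_act x"
    using Q8.orbit_act[of g x] assms by simp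
  then have dom: "Q8_act g x \<in> chart_domain c \<longleftrightarrow> x \<in> chart_domain c" for c
    using assms Q8_act_S7 by (simp add: chart_domain_def)
  show ?thesis
    unfolding tangent_class_def prod.case orb dom
    by (rule image_cong) (simp_all add: chart_deriv_equivariant assms(1))
qed

lemma tangent_class_add_radial: "tangent_class (x, u + r *\<^sub>R x) = tangent_class (x, u)"
  unfolding tangent_class_def prod.case
  by (rule image_cong) (simp_all add: chart_deriv_add_radial)

section \<open>Topology and operations of the tangent bundle\<close>

lemma tangent_total:
  "vb_total TB = quotient_topology
     (sum_topology (\<lambda>c. prod_topology (subtopology S7_mod_Q8 (fst c)) euclidean) S7_mod_Q8_atlas)
     (\<lambda>t. tangent_rel S7_mod_Q8_atlas `` {t})"
  by (simp add: tangent_bundle_def)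

lemma tangent_total_cases:
  assumes "e \<in> topspace (vb_total TB)"
  obtains x u where "x \<in> S7" "x \<bullet> u = 0" "e = tangent_class (x, u)"
proof -
  obtain c p v where c: "c \<in> S7_mod_Q8_atlas" "p \<in> topspace S7_mod_Q8" "p \<in> fst c"
      "e = tangent_rel S7_mod_Q8_atlas `` {(c, p, v)}"
    using assms unfolding tangent_total topspace_quotient_topology by auto
  have "p \<in> orbit Q8 Q8_act ` S7" using S7.onto c(2) by simp
  then obtain x where x: "x \<in> S7" "p = orbit Q8 Q8_act x" by blast
  then have dom: "x \<in> chart_domain c" using c(3) by (simp add: chart_domain_def)
  have "e = tangent_class (x, chart_lift c x v)"
    using tangent_rel_image[OF c(1) dom] c(4) x(2) by simp
  then show thesis using that[OF x(1) chart_lift_orthogonal[OF c(1) dom]] by simp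
qed

lemma tangent_class_as_image:
  assumes "c \<in> S7_mod_Q8_atlas" "x \<in> chart_domain c"
  shows "tangent_class (x, u) = tangent_rel S7_mod_Q8_atlas `` {(c, orbit Q8 Q8_act x, chart_deriv c x u)}"
  unfolding tangent_rel_image[OF assms] chart_lift_deriv[OF assms]
  using tangent_class_add_radial[of x u "- (x \<bullet> u)"] by simp

lemma tangent_class_in_total:
  assumes "x \<in> S7"
  shows "tangent_class (x, u) \<in> topspace (vb_total TB)"
proof -
  obtain c where c: "c \<in> S7_mod_Q8_atlas" "x \<in> chart_domain c" using chart_at[OF assms] .
  moreover have "orbit Q8 Q8_act x \<in> topspace S7_mod_Q8 \<inter> fst c"
    using c(2) S7.onto by (auto simp: chart_domain_def)
  ultimately show ?thesis
    unfolding tangent_total topspace_quotient_topology tangent_class_as_image[OF c]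
    by (intro imageI) simp
qed

text \<open>Over the domain of one chart the map factors through that chart's piece of the disjoint
  sum, where it is continuous by joint continuity of \<open>chart_deriv\<close>.\<close>

lemma continuous_map_tangent_class:
  "continuous_map (prod_topology (top_of_set S7) euclidean) (vb_total TB) tangent_class"
proof (rule continuous_map_locally)
  fix z assume "z \<in> topspace (prod_topology (top_of_set S7) (euclidean :: (quat \<times> quat) topology))"
  then obtain x u where z: "z = (x, u)" "x \<in> S7" by auto
  obtain c where c: "c \<in> S7_mod_Q8_atlas" "x \<in> chart_domain c" using chart_at[OF z(2)] .
  let ?N = "chart_domain c \<times> (UNIV :: (quat \<times> quat) set)"
  let ?X = "subtopology (prod_topology (top_of_set S7) euclidean) ?N"
  have sub: "?X = top_of_set ?N"
    by (auto simp: prod_topology_top_of_set_euclidean subtopology_subtopology chart_domain_def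
        intro!: arg_cong[where f = top_of_set])
  have "continuous_map ?X (prod_topology (subtopology S7_mod_Q8 (fst c)) euclidean)
      (\<lambda>z. (orbit Q8 Q8_act (fst z), chart_deriv c (fst z) (snd z)))"
    unfolding continuous_map_paired
  proof
    have "continuous_map ?X S7_mod_Q8 (orbit Q8 Q8_act \<circ> fst)"
      by (intro continuous_map_compose[OF _ S7.cont] continuous_map_from_subtopology continuous_map_fst)
    then show "continuous_map ?X (subtopology S7_mod_Q8 (fst c)) (\<lambda>z. orbit Q8 Q8_act (fst z))"
      by (auto simp: continuous_map_in_subtopology o_def chart_domain_def)
    show "continuous_map ?X euclidean (\<lambda>z. chart_deriv c (fst z) (snd z))"
      using continuous_on_chart_deriv[OF c(1)] by (simp add: sub case_prod_unfold)
  qed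
  from continuous_map_compose[OF continuous_map_compose[OF this
        continuous_map_component_injection[OF c(1),
          of "\<lambda>c. prod_topology (subtopology S7_mod_Q8 (fst c)) (euclidean :: (real^7) topology)"]]
      quotient_imp_continuous_map[OF quotient_map_quotient_topology]]
  have "continuous_map ?X (vb_total TB) ((\<lambda>t. tangent_rel S7_mod_Q8_atlas `` {t}) \<circ>
      (Pair c \<circ> (\<lambda>z. (orbit Q8 Q8_act (fst z), chart_deriv c (fst z) (snd z)))))"
    unfolding tangent_total .
  then have "continuous_map ?X (vb_total TB) tangent_class"
    by (rule continuous_map_eq) (auto simp: tangent_class_as_image[OF c(1)])
  moreover have "openin (prod_topology (top_of_set S7) euclidean) ?N"
    using openin_chart_domain[OF c(1)] by (simp add: openin_prod_Times_iff)
  ultimately show "\<exists>N. openin (prod_topology (top_of_set S7) euclidean) N \<and> z \<in> N \<and>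
      continuous_map (subtopology (prod_topology (top_of_set S7) euclidean) N) (vb_total TB) tangent_class"
    using z c by blast
qed

lemma mem_tangent_class:
  "(c, p, v) \<in> tangent_class (x, u) \<longleftrightarrow>
    c \<in> S7_mod_Q8_atlas \<and> x \<in> chart_domain c \<and> p = orbit Q8 Q8_act x \<and> v = chart_deriv c x u"
  unfolding tangent_class_def by blast

text \<open>In a chart \<open>c\<close> the preimage of the image of \<open>Q\<close> is the image, under \<open>\<pi> \<times> id\<close>, of the set
  of all \<open>(x, v)\<close> with \<open>(x, chart_lift c x v) \<in> Q\<close>.\<close>

lemma openin_tangent_image:
  assumes "openin (top_of_set S7) W" "open N"
  shows "openin (vb_total TB) (tangent_class ` {(x, u). x \<in> W \<and> u \<in> N \<and> x \<bullet> u = 0})"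
proof -
  let ?Q = "{(x, u). x \<in> W \<and> u \<in> N \<and> x \<bullet> u = 0}"
  let ?cl = "\<lambda>t. tangent_rel S7_mod_Q8_atlas `` {t}"
  have WS: "W \<subseteq> S7" using openin_imp_subset[OF assms(1)] .
  have pre: "{y. (c, y) \<in> {t \<in> Sigma S7_mod_Q8_atlas (\<lambda>c. (topspace S7_mod_Q8 \<inter> fst c) \<times> UNIV).
        ?cl t \<in> tangent_class ` ?Q}} =
      (\<lambda>(x, v). (orbit Q8 Q8_act x, v)) ` {(x, v). x \<in> chart_domain c \<inter> W \<and> chart_lift c x v \<in> N}"
    (is "?L = ?R") if c: "c \<in> S7_mod_Q8_atlas" for c
  proof (rule Set.set_eqI, rule iffI)
    fix y assume "y \<in> ?L"
    then obtain p v x u where y: "y = (p, v)" "p \<in> topspace S7_mod_Q8" "p \<in> fst c"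
      and x: "x \<in> W" "u \<in> N" "x \<bullet> u = 0" "?cl (c, p, v) = tangent_class (x, u)"
      by auto
    have "p \<in> orbit Q8 Q8_act ` S7" using S7.onto y(2) by simp
    then obtain z where z: "z \<in> S7" "p = orbit Q8 Q8_act z" by blast
    then have zc: "z \<in> chart_domain c" using y(3) by (simp add: chart_domain_def)
    \<comment> \<open>The point \<open>z\<close> over \<open>p\<close> was arbitrary; equality of
      classes transfers this triple to the class of \<open>(x, u)\<close>, whose base point does lie
      in \<open>W\<close>.\<close>
    have "(c, p, v) \<in> tangent_class (z, chart_lift c z v)"
      using z c zc chart_deriv_lift[OF c zc] by (simp add: mem_tangent_class)
    also have "tangent_class (z, chart_lift c z v) = tangent_class (x, u)"
      using tangent_rel_image[OF c zc] x(4) z(2) by simp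
    finally have *: "x \<in> chart_domain c" "p = orbit Q8 Q8_act x" "v = chart_deriv c x u"
      unfolding mem_tangent_class by blast+
    then have "chart_lift c x v = u" using chart_lift_deriv[OF c *(1)] x(3) by simp
    then show "y \<in> ?R" using * x y(1) by (intro image_eqI[of _ _ "(x, v)"]) auto
  next
    fix y assume "y \<in> ?R"
    then obtain x v where x: "y = (orbit Q8 Q8_act x, v)" "x \<in> chart_domain c" "x \<in> W"
      "chart_lift c x v \<in> N" by auto
    have "?cl (c, y) \<in> tangent_class ` ?Q"
      unfolding x(1) tangent_rel_image[OF c x(2)]
      using x chart_lift_orthogonal[OF c x(2)] by (intro imageI) auto
    moreover have "orbit Q8 Q8_act x \<in> topspace S7_mod_Q8 \<inter> fst c"
      using x(2) S7.onto by (auto simp: chart_domain_def)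
    ultimately show "y \<in> ?L" using x(1) c by auto
  qed
  have op: "openin (prod_topology (subtopology S7_mod_Q8 (fst c)) euclidean)
      ((\<lambda>(x, v). (orbit Q8 Q8_act x, v)) ` {(x, v). x \<in> chart_domain c \<inter> W \<and> chart_lift c x v \<in> N})"
    if c: "c \<in> S7_mod_Q8_atlas" for c
  proof -
    let ?P = "{(x, v). x \<in> chart_domain c \<inter> W \<and> chart_lift c x v \<in> N}"
    let ?D = "(chart_domain c \<inter> W) \<times> (UNIV :: (real^7) set)"
    have D: "openin (top_of_set (S7 \<times> UNIV)) ?D"
      using openin_Int[OF openin_chart_domain[OF c] assms(1)]
      by (simp add: openin_prod_Times_iff flip: prod_topology_top_of_set_euclidean)
    have "continuous_on ?D (\<lambda>(x, v). chart_lift c x v)"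
      by (rule continuous_on_subset[OF continuous_on_chart_lift[OF c]]) auto
    then have "openin (top_of_set ?D) (?D \<inter> (\<lambda>(x, v). chart_lift c x v) -` N)"
      using assms(2) by (rule continuous_openin_preimage_gen)
    then have "openin (top_of_set (S7 \<times> UNIV)) (?D \<inter> (\<lambda>(x, v). chart_lift c x v) -` N)"
      using D openin_trans by blast
    moreover have "?D \<inter> (\<lambda>(x, v). chart_lift c x v) -` N = ?P" by auto
    ultimately have P: "openin (prod_topology (top_of_set S7) euclidean) ?P"
      by (simp only: prod_topology_top_of_set_euclidean)
    have "openin (prod_topology S7_mod_Q8 euclidean) ((\<lambda>(x, v). (orbit Q8 Q8_act x, v)) ` ?P)"
    \<comment> \<open>The product of the open orbit map with the identity is open, checked on
      boxes.\<close>
    proof (subst openin_subopen, intro ballI)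
      fix y assume "y \<in> (\<lambda>(x, v). (orbit Q8 Q8_act x, v)) ` ?P"
      then obtain x v where x: "y = (orbit Q8 Q8_act x, v)" "(x, v) \<in> ?P" by auto
      have "\<exists>A B. openin (top_of_set S7) A \<and> openin euclidean B \<and> x \<in> A \<and> v \<in> B \<and> A \<times> B \<subseteq> ?P"
        using P x(2) unfolding openin_prod_topology_alt by blast
      then obtain A B where AB: "openin (top_of_set S7) A" "openin euclidean B" "x \<in> A" "v \<in> B"
        "A \<times> B \<subseteq> ?P" by blast
      have "openin (prod_topology S7_mod_Q8 euclidean) (orbit Q8 Q8_act ` A \<times> B)"
        using S7.openin_image[OF AB(1)] AB(2) by (simp add: openin_prod_Times_iff)
      moreover have "y \<in> orbit Q8 Q8_act ` A \<times> B" using x AB by auto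
      moreover have "orbit Q8 Q8_act ` A \<times> B \<subseteq> (\<lambda>(x, v). (orbit Q8 Q8_act x, v)) ` ?P"
        using AB(5) by force
      ultimately show "\<exists>T. openin (prod_topology S7_mod_Q8 euclidean) T \<and> y \<in> T \<and>
          T \<subseteq> (\<lambda>(x, v). (orbit Q8 Q8_act x, v)) ` ?P" by blast
    qed
    moreover have "(\<lambda>(x, v). (orbit Q8 Q8_act x, v)) ` ?P \<subseteq> fst c \<times> UNIV"
      by (auto simp: chart_domain_def)
    moreover have "prod_topology (subtopology S7_mod_Q8 (fst c)) euclidean =
        subtopology (prod_topology S7_mod_Q8 euclidean) (fst c \<times> (UNIV :: (real^7) set))"
      by (simp add: subtopology_Times)
    ultimately show ?thesis by (simp only: subset_openin_subtopology)
  qed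
  have "openin (sum_topology (\<lambda>c. prod_topology (subtopology S7_mod_Q8 (fst c)) euclidean) S7_mod_Q8_atlas)
      {t \<in> Sigma S7_mod_Q8_atlas (\<lambda>c. (topspace S7_mod_Q8 \<inter> fst c) \<times> UNIV). ?cl t \<in> tangent_class ` ?Q}"
    unfolding openin_sum_topology
  proof (intro conjI ballI)
    fix c assume c: "c \<in> S7_mod_Q8_atlas"
    show "openin (prod_topology (subtopology S7_mod_Q8 (fst c)) euclidean)
        {y. (c, y) \<in> {t \<in> Sigma S7_mod_Q8_atlas (\<lambda>c. (topspace S7_mod_Q8 \<inter> fst c) \<times> UNIV).
          ?cl t \<in> tangent_class ` ?Q}}"
      unfolding pre[OF c] by (rule op[OF c])
  qed auto
  moreover have "tangent_class ` ?Q \<subseteq> topspace (vb_total TB)"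
    using tangent_class_in_total WS by auto
  ultimately show ?thesis
    unfolding tangent_total openin_quotient_topology topspace_quotient_topology by (simp add: o_def)
qed

text \<open>The line is modelled by sequences in \<open>Euclidean_space 1\<close>, so the radial
  component sits at index 0.\<close>

definition tangent_sum_map where
  "tangent_sum_map = (\<lambda>(x, u). (tangent_class (x, u), (orbit Q8 Q8_act x, \<lambda>i::nat. if i < 1 then x \<bullet> u else 0)))"

lemma tangent_proj:
  assumes "x \<in> S7"
  shows "vb_proj TB (tangent_class (x, u)) = orbit Q8 Q8_act x"
proof -
  obtain c where c: "c \<in> S7_mod_Q8_atlas" "x \<in> chart_domain c" using chart_at[OF assms] .
  have "(THE p. \<exists>c v. (c, p, v) \<in> tangent_class (x, u)) = orbit Q8 Q8_act x"
    unfolding mem_tangent_class by (rule the_equality) (use c in blast)+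
  then show ?thesis by (simp add: tangent_bundle_def)
qed

lemma tangent_add:
  "vb_add TB (tangent_class (x, u)) (tangent_class (x, w)) = tangent_class (x, u + w)"
proof -
  have "vb_add TB (tangent_class (x, u)) (tangent_class (x, w)) =
      {(c, orbit Q8 Q8_act x, chart_deriv c x u + chart_deriv c x w) | c.
        c \<in> S7_mod_Q8_atlas \<and> x \<in> chart_domain c}"
    \<comment> \<open>A class contains exactly one vector per chart at the point, so matching the
      chart already pairs the right summands.\<close>
    unfolding tangent_bundle_def vbundle.simps mem_tangent_class by blast
  also have "\<dots> = tangent_class (x, u + w)"
    unfolding tangent_class_def prod.case setcompr_eq_image
    by (rule image_cong) (simp_all add: linear_add[OF linear_chart_deriv])
  finally show ?thesis .
qed

lemma tangent_scale: "vb_scale TB r (tangent_class (x, u)) = tangent_class (x, r *\<^sub>R u)"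
proof -
  have "vb_scale TB r (tangent_class (x, u)) =
      {(c, orbit Q8 Q8_act x, r *\<^sub>R chart_deriv c x u) | c.
        c \<in> S7_mod_Q8_atlas \<and> x \<in> chart_domain c}"
    unfolding tangent_bundle_def vbundle.simps mem_tangent_class by blast
  also have "\<dots> = tangent_class (x, r *\<^sub>R u)"
    unfolding tangent_class_def prod.case setcompr_eq_image
    by (rule image_cong) (simp_all add: linear_cmul[OF linear_chart_deriv])
  finally show ?thesis .
qed

lemma tangent_sum_map_equivariant:
  assumes "g \<in> carrier Q8" "x \<in> S7"
  shows "tangent_sum_map (Q8_act g x, Q8_act g u) = tangent_sum_map (x, u)"
proof -
  have "orbit Q8 Q8_act (Q8_act g x) = orbit Q8 Q8_act x" using Q8.orbit_act[of g x] assms by simp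
  then show ?thesis
    by (simp only: tangent_sum_map_def prod.case tangent_class_equivariant[OF assms]
        inner_Q8_act[OF assms(1)])
qed

section \<open>The tangent bundle plus a trivial line, presented over the sphere\<close>

abbreviation (input) TB_sum where "TB_sum \<equiv> TB \<oplus>\<^sub>V trivial_bundle S7_mod_Q8 1"

lemma TB_sum_total:
  "vb_total TB_sum = subtopology (prod_topology (vb_total TB) (prod_topology S7_mod_Q8 (Euclidean_space 1)))
     {(e, f). vb_proj TB e = fst f}"
  by (simp add: whitney_sum_def trivial_bundle_def)

lemma continuous_map_tangent_sum:
  "continuous_map (prod_topology (top_of_set S7) euclidean) (vb_total TB_sum) tangent_sum_map"
proof -
  let ?X = "prod_topology (top_of_set S7) (euclidean :: (quat \<times> quat) topology)"
  have "continuous_map ?X S7_mod_Q8 (\<lambda>z. orbit Q8 Q8_act (fst z))"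
    using continuous_map_compose[OF continuous_map_fst S7.cont] by (simp add: o_def)
  moreover have "continuous_map ?X (Euclidean_space 1) (\<lambda>z i. if i < 1 then fst z \<bullet> snd z else 0)"
    unfolding continuous_map_componentwise_Euclidean_space prod_topology_top_of_set_euclidean
      continuous_map_iff_continuous
    by (intro allI impI continuous_on_inner continuous_on_fst continuous_on_snd continuous_on_id)
  ultimately show ?thesis
    using continuous_map_tangent_class
    unfolding TB_sum_total tangent_sum_map_def
    by (auto simp: continuous_map_in_subtopology continuous_map_paired case_prod_unfold tangent_proj)
qed

lemma tangent_sum_total_cases:
  assumes "e \<in> topspace (vb_total TB_sum)"
  obtains x u r where "x \<in> S7" "x \<bullet> u = 0"
    "e = (tangent_class (x, u), (orbit Q8 Q8_act x, \<lambda>i. if i < 1 then r else 0))"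
proof -
  obtain e' p s where e: "e = (e', (p, s))" "e' \<in> topspace (vb_total TB)" "vb_proj TB e' = p"
      "s \<in> topspace (Euclidean_space 1)"
    using assms unfolding TB_sum_total by auto
  obtain x u where x: "x \<in> S7" "x \<bullet> u = 0" "e' = tangent_class (x, u)"
    using tangent_total_cases[OF e(2)] .
  have "s = (\<lambda>i. if i < 1 then s 0 else 0)" using e(4) by (auto simp: topspace_Euclidean_space)
  then show thesis using that[OF x(1,2), of "s 0"] e x tangent_proj[OF x(1)] by simp
qed

lemma tangent_sum_map_split:
  assumes "x \<in> S7" "x \<bullet> u = 0"
  shows "tangent_sum_map (x, u + r *\<^sub>R x) =
    (tangent_class (x, u), (orbit Q8 Q8_act x, \<lambda>i. if i < 1 then r else 0))"
  using assms by (auto simp: tangent_sum_map_def tangent_class_add_radial inner_add_right S7_inner_self)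

text \<open>\<open>openin_tangent_image\<close> concerns vectors orthogonal to the base point. So
  \<open>u\<close> is split into a tangential and a radial part, and a neighbourhood is chosen for
  each separately.\<close>

lemma open_map_tangent_sum:
  "open_map (prod_topology (top_of_set S7) euclidean) (vb_total TB_sum) tangent_sum_map"
  unfolding open_map_def
proof (intro allI impI)
  let ?X = "prod_topology (top_of_set S7) (euclidean :: (quat \<times> quat) topology)"
  fix O' assume O': "openin ?X O'"
  show "openin (vb_total TB_sum) (tangent_sum_map ` O')"
  proof (subst openin_subopen, intro ballI)
    fix e assume "e \<in> tangent_sum_map ` O'"
    then obtain x u where xu: "(x, u) \<in> O'" "e = tangent_sum_map (x, u)" by auto
    have x: "x \<in> S7" using openin_subset[OF O'] xu(1) by auto
    define w where "w = u - (x \<bullet> u) *\<^sub>R x"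
    have w: "x \<bullet> w = 0" "u = w + (x \<bullet> u) *\<^sub>R x"
      using S7_inner_self[OF x] by (simp_all add: w_def inner_diff_right)
    obtain P where P: "open P" "O' = (S7 \<times> UNIV) \<inter> P"
      using O' unfolding prod_topology_top_of_set_euclidean openin_open by blast
    \<comment> \<open>Reassembles point, tangential part and radial coefficient; its continuity
      provides a box around \<open>(x, w, x \<bullet> u)\<close> that is mapped into
      \<open>P\<close>.\<close>
    let ?k = "\<lambda>z :: (quat \<times> quat) \<times> (quat \<times> quat) \<times> real. (fst z, fst (snd z) + snd (snd z) *\<^sub>R fst z)"
    have "continuous_on UNIV ?k"
      by (intro continuous_on_Pair continuous_on_add continuous_on_scaleR continuous_on_fst
          continuous_on_snd continuous_on_id)
    then have "open (?k -` P)" using P(1) by (simp add: open_vimage)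
    moreover have "(x, w, x \<bullet> u) \<in> ?k -` P" using xu(1) P(2) w(2) by simp
    ultimately obtain A C where AC: "open A" "open C" "(x, w, x \<bullet> u) \<in> A \<times> C" "A \<times> C \<subseteq> ?k -` P"
      by (rule open_prod_elim)
    then have "(w, x \<bullet> u) \<in> C" by simp
    with AC(2) obtain V1 V2 where V: "open V1" "open V2" "(w, x \<bullet> u) \<in> V1 \<times> V2" "V1 \<times> V2 \<subseteq> C"
      by (rule open_prod_elim)
    define W where "W = S7 \<inter> A"
    have W: "openin (top_of_set S7) W" "x \<in> W" "W \<subseteq> S7" "W \<subseteq> A"
      using AC x by (auto simp: W_def)
    let ?T1 = "tangent_class ` {(y, v). y \<in> W \<and> v \<in> V1 \<and> y \<bullet> v = 0}"
    let ?T2 = "{s \<in> topspace (Euclidean_space 1). s 0 \<in> V2}"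
    let ?T = "?T1 \<times> (orbit Q8 Q8_act ` W \<times> ?T2) \<inter> {(e, f). vb_proj TB e = fst f}"
    have "continuous_map (Euclidean_space 1) euclideanreal (\<lambda>s. s 0)"
      unfolding continuous_map_Euclidean_space_iff
      by (rule continuous_on_subset[OF continuous_on_product_coordinates]) simp
    then have "openin (Euclidean_space 1) ?T2"
      using V(2) by (intro openin_continuous_map_preimage) auto
    then have "openin (vb_total TB_sum) ?T"
      unfolding TB_sum_total
      by (intro openin_subtopology_Int)
        (simp add: openin_prod_Times_iff openin_tangent_image[OF W(1) V(1)] S7.openin_image[OF W(1)])
    moreover have "e \<in> ?T"
    proof -
      have "e = (tangent_class (x, w), (orbit Q8 Q8_act x, \<lambda>i. if i < 1 then x \<bullet> u else 0))"
        using tangent_sum_map_split[OF x w(1), of "x \<bullet> u"] w(2) xu(2) by simp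
      then show ?thesis
        using W V w(1) x by (auto simp: tangent_proj topspace_Euclidean_space)
    qed
    moreover have "?T \<subseteq> tangent_sum_map ` O'"
    proof
      fix t assume "t \<in> ?T"
      then obtain y v z s where t: "t = (tangent_class (y, v), (orbit Q8 Q8_act z, s))" "y \<in> W" "v \<in> V1"
        "y \<bullet> v = 0" "z \<in> W" "s \<in> topspace (Euclidean_space 1)" "s 0 \<in> V2"
        "vb_proj TB (tangent_class (y, v)) = orbit Q8 Q8_act z"
        by auto
      have y: "y \<in> S7" using t(2) W(3) by blast
      \<comment> \<open>The points \<open>y\<close> and \<open>z\<close> may differ, but only the
        orbit of \<open>z\<close> enters \<open>t\<close>, so \<open>y\<close> can serve for both
        components.\<close>
      have orb: "orbit Q8 Q8_act z = orbit Q8 Q8_act y" using t(8) tangent_proj[OF y] by simp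
      have "s = (\<lambda>i. if i < 1 then s 0 else 0)" using t(6) by (auto simp: topspace_Euclidean_space)
      then have "t = tangent_sum_map (y, v + s 0 *\<^sub>R y)"
        using tangent_sum_map_split[OF y t(4), of "s 0"] t(1) orb by simp
      moreover have "(y, v + s 0 *\<^sub>R y) \<in> O'"
      proof -
        have "(y, v, s 0) \<in> A \<times> C" using t W(4) V(4) by blast
        then have "?k (y, v, s 0) \<in> P" using AC(4) by blast
        then show ?thesis using P(2) y by simp
      qed
      ultimately show "t \<in> tangent_sum_map ` O'" by blast
    qed
    ultimately show "\<exists>T. openin (vb_total TB_sum) T \<and> e \<in> T \<and> T \<subseteq> tangent_sum_map ` O'" by blast
  qed
qed

lemma presented_bundle_tangent_sum:
  "presented_bundle (top_of_set S7) S7_mod_Q8 (orbit Q8 Q8_act) TB_sum tangent_sum_map"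
proof
  show "tangent_sum_map ` (topspace (top_of_set S7) \<times> UNIV) = topspace (vb_total TB_sum)"
  proof
    show "tangent_sum_map ` (topspace (top_of_set S7) \<times> UNIV) \<subseteq> topspace (vb_total TB_sum)"
      using continuous_map_image_subset_topspace[OF continuous_map_tangent_sum] by simp
    show "topspace (vb_total TB_sum) \<subseteq> tangent_sum_map ` (topspace (top_of_set S7) \<times> UNIV)"
    proof
      fix e assume "e \<in> topspace (vb_total TB_sum)"
      then obtain x u r where x: "x \<in> S7" "x \<bullet> u = 0"
          "e = (tangent_class (x, u), (orbit Q8 Q8_act x, \<lambda>i. if i < 1 then r else 0))"
        by (rule tangent_sum_total_cases)
      then have "e = tangent_sum_map (x, u + r *\<^sub>R x)"
        by (simp only: tangent_sum_map_split[OF x(1,2)])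
      then show "e \<in> tangent_sum_map ` (topspace (top_of_set S7) \<times> UNIV)"
        using x(1) by (intro image_eqI[of _ _ "(x, u + r *\<^sub>R x)"]) simp_all
    qed
  qed
  show "u = w" if "x \<in> topspace (top_of_set S7)" "tangent_sum_map (x, u) = tangent_sum_map (x, w)" for x u w
  proof -
    have x: "x \<in> S7" using that(1) by simp
    obtain c where c: "c \<in> S7_mod_Q8_atlas" "x \<in> chart_domain c" using chart_at[OF x] .
    have inner: "x \<bullet> u = x \<bullet> w"
      using arg_cong[OF that(2), of "\<lambda>z. snd (snd z) 0"] by (simp add: tangent_sum_map_def)
    have class_eq: "tangent_class (x, u) = tangent_class (x, w)"
      using arg_cong[OF that(2), of fst] by (simp only: tangent_sum_map_def prod.case fst_conv)
    have "(c, orbit Q8 Q8_act x, chart_deriv c x u) \<in> tangent_class (x, w)"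
      unfolding class_eq[symmetric] mem_tangent_class using c by simp
    then have deriv: "chart_deriv c x u = chart_deriv c x w" by (simp only: mem_tangent_class)
    \<comment> \<open>The tangential part is recovered from the tangent class in any one chart; the
      radial part was read off from the trivial summand.\<close>
    have "u - (x \<bullet> u) *\<^sub>R x = chart_lift c x (chart_deriv c x u)"
      by (rule chart_lift_deriv[OF c, symmetric])
    also have "\<dots> = w - (x \<bullet> w) *\<^sub>R x"
      unfolding deriv by (rule chart_lift_deriv[OF c])
    finally show ?thesis unfolding inner by (metis diff_add_cancel)
  qed
  show "\<exists>w. tangent_sum_map (y, v) = tangent_sum_map (x, w)"
    if xy: "x \<in> topspace (top_of_set S7)" "y \<in> topspace (top_of_set S7)"
      "orbit Q8 Q8_act x = orbit Q8 Q8_act y" for x y v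
  proof -
    obtain g where "g \<in> carrier Q8" "x = Q8_act g y"
      using xy orbit_eq_iff_S7[of y x] by auto
    then have "tangent_sum_map (y, v) = tangent_sum_map (x, Q8_act g v)"
      using tangent_sum_map_equivariant[of g y v] xy(2) by simp
    then show ?thesis by (rule exI)
  qed
  show "vb_add TB_sum (tangent_sum_map (x, v)) (tangent_sum_map (x, w)) = tangent_sum_map (x, v + w)"
    if "x \<in> topspace (top_of_set S7)" for x v w
    by (auto simp: whitney_sum_def trivial_bundle_def tangent_sum_map_def tangent_add inner_add_right)
  show "vb_scale TB_sum r (tangent_sum_map (x, v)) = tangent_sum_map (x, r *\<^sub>R v)"
    if "x \<in> topspace (top_of_set S7)" for x r v
    by (auto simp: whitney_sum_def trivial_bundle_def tangent_sum_map_def tangent_scale)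
  show "vb_proj TB_sum (tangent_sum_map (x, v)) = orbit Q8 Q8_act x"
    if "x \<in> topspace (top_of_set S7)" for x v
    using that by (simp add: whitney_sum_def tangent_sum_map_def tangent_proj)
  show "vb_base TB_sum = S7_mod_Q8"
    by (simp add: whitney_sum_def tangent_bundle_def)
qed (fact continuous_map_tangent_sum open_map_tangent_sum)+

theorem theorem1p1:
  shows "tangent_bundle S7_mod_Q8 S7_mod_Q8_atlas \<oplus>\<^sub>V trivial_bundle S7_mod_Q8 1
           \<cong>\<^sub>\<real> underlying_real eta \<oplus>\<^sub>V underlying_real eta"
proof (rule isomorphic_of_presentations[OF presented_bundle_tangent_sum
      presented_bundle_whitney_sum[OF presented_bundle_eta presented_bundle_eta]])
  let ?r = "\<lambda>(x, h, k). (eta_map (x, h), eta_map (x, k))"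
  fix a b assume ab: "a \<in> topspace (top_of_set S7) \<times> (UNIV :: (quat \<times> quat) set)"
    "b \<in> topspace (top_of_set S7) \<times> (UNIV :: (quat \<times> quat) set)"
  \<comment> \<open>The model fibre \<open>quat \<times> quat\<close> is the ambient space of the
    sphere on one side and two copies of the representation on the other; in both roles
    \<open>g\<close> acts by \<open>Q8_act g\<close>, so the two kernels agree.\<close>
  have equiv: "?r (Q8_act g x, Q8_act g u) = ?r (x, u)" if "g \<in> carrier Q8" "x \<in> S7" for g x u
    using eta_map_equivariant[OF that] by (simp add: Q8_act_def[of g u] case_prod_unfold)
  obtain x u y w where *: "a = (x, u)" "b = (y, w)" "x \<in> S7" "y \<in> S7"
    using ab by (cases a; cases b) auto
  have "?r (x, u) = ?r (y, w) \<longleftrightarrow> (\<exists>g\<in>carrier Q8. y = Q8_act g x \<and> w = Q8_act g u)"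
    by (rule kernel_of_equivariant_presentation[OF
          presented_bundle_whitney_sum[OF presented_bundle_eta presented_bundle_eta] _ *(3,4)])
      (rule equiv)
  moreover have "tangent_sum_map (x, u) = tangent_sum_map (y, w) \<longleftrightarrow>
      (\<exists>g\<in>carrier Q8. y = Q8_act g x \<and> w = Q8_act g u)"
    by (rule kernel_of_equivariant_presentation[OF presented_bundle_tangent_sum _ *(3,4)])
      (rule tangent_sum_map_equivariant)
  ultimately show "tangent_sum_map a = tangent_sum_map b \<longleftrightarrow> ?r a = ?r b"
    by (simp only: *(1,2))
qed

end
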